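(* Consider the sequence of closed infinite-server systems with vector-packing constraints described in the context, indexed by $r$, operating under the Greedy-D-AC discipline (Greedy with aggregate configurations) with $\alpha>0$, and let $x^r(\infty)$ denote the random state of the fluid-scaled process $x^r(\cdot)=X^r(\cdot)/r$ in a stationary regime. Then, as $r\to\infty$, $$d(x^r(\infty),\mathcal X^* )\Longrightarrow 0,$$ where $\mathcal X^*$ is the set of optimal solutions of the convex problem of minimizing $\Phi(x)=\sum_{q\in\mathcal Q}(1+\alpha)^{-1}\big[\sum_{k\in q}x_k\big]^{1+\alpha}$ over $x\in\mathbb R_+^{|\mathcal K|}$ subject to $\sum_{k\in\mathcal K}k_ix_k=\rho_i$ for all $i$.
   Context: Vector packing. $\mathcal I=\{1,\dots,I\}$ is the set of customer types. There are $N$ resources, with $B_n>0$ the amount of resource $n$ at each server and $b_{i,n}>0$ the requirement of a type $i$ customer. The set of configurations is $\bar{\mathcal K}=\{k\in\mathbb Z_+^I:\sum_ik_ib_{i,n}\le B_n\ \forall n\}$, and every unit vector $e_i$ is assumed to lie in $\bar{\mathcal K}$. $\mathcal K=\bar{\mathcal K}\setminus\{0\}$. There are infinitely many servers; a server in configuration $k$ is serving $k_i$ customers of type $i$. $X_k$ is the number of servers in configuration $k\in\mathcal K$; $X=\{X_k\}_{k\in\mathcal K}$. Aggregate configurations. $k,k'\in\bar{\mathcal K}$ are equivalent if $\sum_ik_ib_{i,n}=\sum_ik'_ib_{i,n}$ for all $n$. An equivalence class is called an aggregate configuration (a-configuration). $\bar{\mathcal Q}$ is the set of all a-configurations; the class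 of $k=0$ is denoted $q=0$; $\mathcal Q=\bar{\mathcal Q}\setminus\{0\}$. $X_q=\sum_{k\in q}X_k$. For $q\in\bar{\mathcal Q}$ such that a type $i$ customer can be added without violating the packing constraints, $q+e_i$ is the a-configuration containing all $k+e_i$, $k\in q$. Parameters. $\lambda_i>0$, $\mu_i>0$, $\rho_i=\lambda_i/\mu_i$, $\sum_i\rho_i=1$. The scaling parameter $r\ge1$ increases to infinity along a discrete sequence. Closed system with parameter $r$. There is a fixed number $\rho_i r$ (assumed integer) of type $i$ customers; no exogenous arrivals. Every type $i$ customer in service completes service at rate $\mu_i$ (independent exponential service times, unaffected by other customers in the same server). When a type $i$ customer completes service in a server of configuration $k$, the server's configuration becomes $k-e_i$ and the customer is immediately placed into a server for a new service as chosen by the discipline. $X^r(\cdot)$ is the resulting finite-state Markov chain. Greedy-D-AC discipline. A type $i$ customer to be placed at time $t$ is added to an available a-configuration $q$ ($q=0$ or $X_q(t-)>0$) such that the addition does not violate the packing constraints and $X_{q+e_i}(t-)^\alpha-I\{q\ne0\}X_q(t-)^\alpha$ is smallest, where $t-$ refers to the state after the service completion and before the placement. Ties between a-configurations are broken by an arbitrary deterministic rule; the server within the chosen a-configuration is chosen uniformly at random among the servers in that a-configuration (an empty server if $q=0$). $d(\cdot,U)$ is Euclidean distance to the set $U$; $\Longrightarrow$ is convergence in distribution. *)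

theory Defs
  imports "HOL-Probability.Probability"
begin

section \<open>Configurations\<close>

text \<open>Customer types and resources are indexed by finite types. The system state
  \<open>X\<close> gives the number \<open>X k\<close> of servers in each nonzero configuration \<open>k\<close>; there
  are always infinitely many empty servers, and these are not counted.\<close>

type_synonym 'i config = "'i \<Rightarrow> nat"
type_synonym 'i state = "'i config \<Rightarrow> nat"
type_synonym 'i aconf = "'i config set"

definition empty_config :: "'i config" where
  "empty_config = (\<lambda>_. 0)"

definition add_cust :: "'i \<Rightarrow> 'i config \<Rightarrow> 'i config" where
  "add_cust i k = k(i := k i + 1)"

definition del_cust :: "'i \<Rightarrow> 'i config \<Rightarrow> 'i config" where
  "del_cust i k = k(i := k i - 1)"

definition usage :: "('i::finite \<Rightarrow> 'n \<Rightarrow> real) \<Rightarrow> 'i config \<Rightarrow> 'n \<Rightarrow> real" where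
  "usage b k n = (\<Sum>i\<in>UNIV. real (k i) * b i n)"

definition configs0 :: "('n \<Rightarrow> real) \<Rightarrow> ('i::finite \<Rightarrow> 'n \<Rightarrow> real) \<Rightarrow> 'i config set" where
  "configs0 B b = {k. \<forall>n. usage b k n \<le> B n}"

definition configs :: "('n \<Rightarrow> real) \<Rightarrow> ('i::finite \<Rightarrow> 'n \<Rightarrow> real) \<Rightarrow> 'i config set" where
  "configs B b = configs0 B b - {empty_config}"


section \<open>Aggregate configurations\<close>

definition conf_equiv ::
  "('n \<Rightarrow> real) \<Rightarrow> ('i::finite \<Rightarrow> 'n \<Rightarrow> real) \<Rightarrow> ('i config \<times> 'i config) set" where
  "conf_equiv B b =
     {(k, k'). k \<in> configs0 B b \<and> k' \<in> configs0 B b \<and> (\<forall>n. usage b k n = usage b k' n)}"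

definition aconfs0 :: "('n \<Rightarrow> real) \<Rightarrow> ('i::finite \<Rightarrow> 'n \<Rightarrow> real) \<Rightarrow> 'i aconf set" where
  "aconfs0 B b = configs0 B b // conf_equiv B b"

definition empty_aconf :: "('n \<Rightarrow> real) \<Rightarrow> ('i::finite \<Rightarrow> 'n \<Rightarrow> real) \<Rightarrow> 'i aconf" where
  "empty_aconf B b = conf_equiv B b `` {empty_config}"

definition aconfs :: "('n \<Rightarrow> real) \<Rightarrow> ('i::finite \<Rightarrow> 'n \<Rightarrow> real) \<Rightarrow> 'i aconf set" where
  "aconfs B b = aconfs0 B b - {empty_aconf B b}"

definition can_add ::
  "('n \<Rightarrow> real) \<Rightarrow> ('i::finite \<Rightarrow> 'n \<Rightarrow> real) \<Rightarrow> 'i \<Rightarrow> 'i aconf \<Rightarrow> bool" where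
  "can_add B b i q \<longleftrightarrow> (\<forall>k\<in>q. add_cust i k \<in> configs0 B b)"

text \<open>For \<open>q\<close> to which a type \<open>i\<close> customer can be added, this is a single equivalence
  class; see \<open>add_aconf_in_aconfs0\<close> below.\<close>

definition add_aconf ::
  "('n \<Rightarrow> real) \<Rightarrow> ('i::finite \<Rightarrow> 'n \<Rightarrow> real) \<Rightarrow> 'i \<Rightarrow> 'i aconf \<Rightarrow> 'i aconf" where
  "add_aconf B b i q = conf_equiv B b `` (add_cust i ` q)"

definition agg :: "('i config \<Rightarrow> 'a::comm_monoid_add) \<Rightarrow> 'i aconf \<Rightarrow> 'a" where
  "agg X q = (\<Sum>k\<in>q. X k)"


section \<open>The Greedy-D-AC discipline\<close>

definition placeable ::
  "('n \<Rightarrow> real) \<Rightarrow> ('i::finite \<Rightarrow> 'n \<Rightarrow> real) \<Rightarrow> 'i state \<Rightarrow> 'i \<Rightarrow> 'i aconf \<Rightarrow> bool" where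
  "placeable B b X i q \<longleftrightarrow>
     q \<in> aconfs0 B b \<and> (q = empty_aconf B b \<or> agg X q > 0) \<and> can_add B b i q"

definition greedy_weight ::
  "('n \<Rightarrow> real) \<Rightarrow> ('i::finite \<Rightarrow> 'n \<Rightarrow> real) \<Rightarrow> real \<Rightarrow> 'i state \<Rightarrow> 'i \<Rightarrow> 'i aconf \<Rightarrow> real" where
  "greedy_weight B b \<alpha> X i q =
     real (agg X (add_aconf B b i q)) powr \<alpha>
     - (if q \<noteq> empty_aconf B b then real (agg X q) powr \<alpha> else 0)"

text \<open>A rule selects an aggregate configuration from the type of the customer to be
  placed and the state just before the placement; it is a Greedy-D-AC rule with
  deterministic (otherwise arbitrary) tie breaking if it always selects a minimizer.\<close>

definition greedy_rule ::
  "('n \<Rightarrow> real) \<Rightarrow> ('i::finite \<Rightarrow> 'n \<Rightarrow> real) \<Rightarrow> real \<Rightarrow> ('i \<Rightarrow> 'i state \<Rightarrow> 'i aconf) \<Rightarrow> bool" where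
  "greedy_rule B b \<alpha> sel \<longleftrightarrow>
     (\<forall>i X. is_arg_min (greedy_weight B b \<alpha> X i) (placeable B b X i) (sel i X))"

text \<open>The servers in an aggregate configuration \<open>q \<noteq> 0\<close> are the pairs \<open>(k, j)\<close> with
  \<open>k \<in> q\<close> and \<open>j < X k\<close>; only the configuration \<open>k\<close> of the chosen server matters.\<close>

definition server_pmf ::
  "('n \<Rightarrow> real) \<Rightarrow> ('i::finite \<Rightarrow> 'n \<Rightarrow> real) \<Rightarrow> 'i state \<Rightarrow> 'i aconf \<Rightarrow> 'i config pmf" where
  "server_pmf B b X q =
     (if q = empty_aconf B b then return_pmf empty_config
      else map_pmf fst (pmf_of_set (SIGMA k:q. {..<X k})))"

text \<open>One server changes from configuration \<open>k\<close> to configuration \<open>k'\<close>.\<close>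

definition change_server :: "'i config \<Rightarrow> 'i config \<Rightarrow> 'i state \<Rightarrow> 'i state" where
  "change_server k k' X =
     (let Y = (if k = empty_config then X else X(k := X k - 1))
      in if k' = empty_config then Y else Y(k' := Y k' + 1))"

definition placement_pmf ::
  "('n \<Rightarrow> real) \<Rightarrow> ('i::finite \<Rightarrow> 'n \<Rightarrow> real) \<Rightarrow> ('i \<Rightarrow> 'i state \<Rightarrow> 'i aconf) \<Rightarrow>
   'i \<Rightarrow> 'i state \<Rightarrow> 'i state pmf" where
  "placement_pmf B b sel i X =
     map_pmf (\<lambda>k. change_server k (add_cust i k) X) (server_pmf B b X (sel i X))"


section \<open>Stationary distributions of finite-state continuous-time Markov chains\<close>

text \<open>A chain on a finite set \<open>S\<close> is given by the rates \<open>w x y\<close> of the jumps from \<open>x\<close>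
  to \<open>y\<close>. Jumps from a state to itself have no effect, so \<open>w x x\<close> is ignored.\<close>

definition generator :: "'s set \<Rightarrow> ('s \<Rightarrow> 's \<Rightarrow> real) \<Rightarrow> 's \<Rightarrow> 's \<Rightarrow> real" where
  "generator S w x y = (if x = y then - (\<Sum>z\<in>S - {x}. w x z) else w x y)"

fun kernel_power :: "'s set \<Rightarrow> ('s \<Rightarrow> 's \<Rightarrow> real) \<Rightarrow> nat \<Rightarrow> 's \<Rightarrow> 's \<Rightarrow> real" where
  "kernel_power S G 0 x y = (if x = y then 1 else 0)"
| "kernel_power S G (Suc m) x y = (\<Sum>z\<in>S. G x z * kernel_power S G m z y)"

text \<open>The transition probabilities are the entries of the matrix exponential of
  \<open>t\<close> times the generator.\<close>

definition trans_prob :: "'s set \<Rightarrow> ('s \<Rightarrow> 's \<Rightarrow> real) \<Rightarrow> real \<Rightarrow> 's \<Rightarrow> 's \<Rightarrow> real" where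
  "trans_prob S w t x y = (\<Sum>m. t ^ m / fact m * kernel_power S (generator S w) m x y)"

definition stationary_dist :: "'s set \<Rightarrow> ('s \<Rightarrow> 's \<Rightarrow> real) \<Rightarrow> 's pmf \<Rightarrow> bool" where
  "stationary_dist S w \<pi> \<longleftrightarrow> set_pmf \<pi> \<subseteq> S \<and>
     (\<forall>t\<ge>0. \<forall>y\<in>S. (\<Sum>x\<in>S. pmf \<pi> x * trans_prob S w t x y) = pmf \<pi> y)"


section \<open>The closed system\<close>

text \<open>States with \<open>\<rho> i * r\<close> customers of each type \<open>i\<close>.\<close>

definition closed_states ::
  "('n \<Rightarrow> real) \<Rightarrow> ('i::finite \<Rightarrow> 'n \<Rightarrow> real) \<Rightarrow> ('i \<Rightarrow> real) \<Rightarrow> real \<Rightarrow> 'i state set" where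
  "closed_states B b \<rho> r =
     {X. (\<forall>k. k \<notin> configs B b \<longrightarrow> X k = 0) \<and>
         (\<forall>i. real (\<Sum>k\<in>configs B b. k i * X k) = \<rho> i * r)}"

definition closed_rate ::
  "('n \<Rightarrow> real) \<Rightarrow> ('i::finite \<Rightarrow> 'n \<Rightarrow> real) \<Rightarrow> ('i \<Rightarrow> real) \<Rightarrow> ('i \<Rightarrow> 'i state \<Rightarrow> 'i aconf) \<Rightarrow>
   'i state \<Rightarrow> 'i state \<Rightarrow> real" where
  "closed_rate B b \<mu> sel X Y =
     (\<Sum>k\<in>configs B b. \<Sum>i\<in>UNIV. \<mu> i * real (k i) * real (X k) *
        pmf (placement_pmf B b sel i (change_server k (del_cust i k) X)) Y)"


section \<open>The fluid optimization problem\<close>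

text \<open>Vectors in \<open>\<real>\<^sup>K\<close> for a finite set \<open>K\<close> are functions vanishing outside \<open>K\<close>.\<close>

definition \<Phi> ::
  "('n \<Rightarrow> real) \<Rightarrow> ('i::finite \<Rightarrow> 'n \<Rightarrow> real) \<Rightarrow> real \<Rightarrow> ('i config \<Rightarrow> real) \<Rightarrow> real" where
  "\<Phi> B b \<alpha> x = (\<Sum>q\<in>aconfs B b. inverse (1 + \<alpha>) * agg x q powr (1 + \<alpha>))"

definition feasible ::
  "('n \<Rightarrow> real) \<Rightarrow> ('i::finite \<Rightarrow> 'n \<Rightarrow> real) \<Rightarrow> ('i \<Rightarrow> real) \<Rightarrow> ('i config \<Rightarrow> real) set" where
  "feasible B b \<rho> =
     {x. (\<forall>k\<in>configs B b. x k \<ge> 0) \<and> (\<forall>k. k \<notin> configs B b \<longrightarrow> x k = 0) \<and>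
         (\<forall>i. (\<Sum>k\<in>configs B b. real (k i) * x k) = \<rho> i)}"

definition optimal ::
  "('n \<Rightarrow> real) \<Rightarrow> ('i::finite \<Rightarrow> 'n \<Rightarrow> real) \<Rightarrow> ('i \<Rightarrow> real) \<Rightarrow> real \<Rightarrow> ('i config \<Rightarrow> real) set" where
  "optimal B b \<rho> \<alpha> = {x. is_arg_min (\<Phi> B b \<alpha>) (\<lambda>y. y \<in> feasible B b \<rho>) x}"

definition fluid :: "real \<Rightarrow> 'i state \<Rightarrow> 'i config \<Rightarrow> real" where
  "fluid r X k = real (X k) / r"

text \<open>Euclidean distance in \<open>\<real>\<^sup>K\<close> to a nonempty set.\<close>

definition eucl_setdist :: "'k set \<Rightarrow> ('k \<Rightarrow> real) \<Rightarrow> ('k \<Rightarrow> real) set \<Rightarrow> real" where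
  "eucl_setdist K x U = (INF y\<in>U. L2_set (\<lambda>k. x k - y k) K)"


section \<open>Well-definedness\<close>

lemma equiv_conf_equiv: "equiv (configs0 B b) (conf_equiv B b)"
proof (rule equivI)
  show "conf_equiv B b \<subseteq> configs0 B b \<times> configs0 B b"
    unfolding conf_equiv_def by blast
  show "refl_on (configs0 B b) (conf_equiv B b)"
    unfolding refl_on_def conf_equiv_def by blast
  show "sym (conf_equiv B b)"
    by (rule symI) (simp add: conf_equiv_def)
  show "trans (conf_equiv B b)"
    by (rule transI) (simp add: conf_equiv_def)
qed

lemma aconfs0_nonempty: "q \<in> aconfs0 B b \<Longrightarrow> q \<noteq> {}"
  unfolding aconfs0_def by (rule in_quotient_imp_non_empty[OF equiv_conf_equiv])

lemma aconfs0_equiv: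
  assumes "q \<in> aconfs0 B b" "k \<in> q" "k' \<in> q"
  shows "(k, k') \<in> conf_equiv B b"
  using quotient_eq_iff[OF equiv_conf_equiv assms(1,1)[unfolded aconfs0_def] assms(2,3)] by simp

lemma usage_add_cust: "usage b (add_cust i k) n = usage b k n + b i n"
proof -
  have "usage b (add_cust i k) n
      = (\<Sum>j\<in>UNIV. real (k j) * b j n + (if j = i then b i n else 0))"
    unfolding usage_def add_cust_def by (rule sum.cong) (auto simp: algebra_simps)
  then show ?thesis
    by (simp add: sum.distrib usage_def)
qed

lemma can_add_iff:
  assumes "q \<in> aconfs0 B b"
  shows "can_add B b i q \<longleftrightarrow> (\<exists>k\<in>q. add_cust i k \<in> configs0 B b)"
proof
  show "\<exists>k\<in>q. add_cust i k \<in> configs0 B b" if "can_add B b i q"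
    using that aconfs0_nonempty[OF assms] unfolding can_add_def by blast
next
  assume "\<exists>k\<in>q. add_cust i k \<in> configs0 B b"
  then obtain k where k: "k \<in> q" "add_cust i k \<in> configs0 B b" by blast
  show "can_add B b i q"
    unfolding can_add_def
  proof
    fix k' assume "k' \<in> q"
    from aconfs0_equiv[OF assms k(1) this] k(2)
    show "add_cust i k' \<in> configs0 B b"
      by (simp add: conf_equiv_def configs0_def usage_add_cust)
  qed
qed

lemma add_aconf_eq:
  assumes "q \<in> aconfs0 B b" "k \<in> q" "can_add B b i q"
  shows "add_aconf B b i q = conf_equiv B b `` {add_cust i k}"
proof -
  have eq: "conf_equiv B b `` {add_cust i k'} = conf_equiv B b `` {add_cust i k}"
    if "k' \<in> q" for k'
  proof (rule equiv_class_eq[OF equiv_conf_equiv])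
    show "(add_cust i k', add_cust i k) \<in> conf_equiv B b"
      using aconfs0_equiv[OF assms(1) that assms(2)] assms(2,3) that
      by (simp add: conf_equiv_def can_add_def usage_add_cust)
  qed
  have "add_aconf B b i q = (\<Union>k'\<in>q. conf_equiv B b `` {add_cust i k'})"
    unfolding add_aconf_def by blast
  also have "\<dots> = (\<Union>k'\<in>q. conf_equiv B b `` {add_cust i k})"
    using eq by (intro SUP_cong) simp_all
  also have "\<dots> = conf_equiv B b `` {add_cust i k}"
    using assms(2) by blast
  finally show ?thesis .
qed

lemma add_aconf_in_aconfs0:
  assumes "q \<in> aconfs0 B b" "can_add B b i q"
  shows "add_aconf B b i q \<in> aconfs0 B b"
    and "add_cust i ` q \<subseteq> add_aconf B b i q"
proof -
  obtain k where k: "k \<in> q"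
    using aconfs0_nonempty[OF assms(1)] by blast
  then have "add_cust i k \<in> configs0 B b"
    using assms(2) by (simp add: can_add_def)
  then show "add_aconf B b i q \<in> aconfs0 B b"
    unfolding add_aconf_eq[OF assms(1) k assms(2)] aconfs0_def by (rule quotientI)
  show "add_cust i ` q \<subseteq> add_aconf B b i q"
    using assms(2) equiv_conf_equiv[of B b]
    unfolding add_aconf_def can_add_def equiv_def refl_on_def by blast
qed

end

theory Submission
  imports Defs
begin

text \<open>A customer leaving a server of configuration \<open>k\<close> may always return to the server it just left,
  so under the greedy rule each move decreases a discrete version of \<open>\<Phi>\<close>, up to a lower-order
  error. In stationarity the expected drift vanishes, hence every decrease is negligible on the
  fluid scale: in a fluid limit \<open>x\<close>, a positive \<open>x k\<close> with \<open>k i > 0\<close> forces the marginal cost of \<open>i\<close>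
  in \<open>k\<close> to be minimal among all occupied aggregate configurations. This alone does not
  give optimality, because a configuration inside an occupied aggregate configuration may
  itself be empty. The uniform choice of servers excludes this: the drift of
  \<open>agg X (cls \<kappa>) * sqrt (X \<kappa> + 1)\<close> yields a bound on
  \<open>x (\<kappa> + e\<^sub>i) * agg x (cls \<kappa>) / sqrt (x \<kappa>)\<close> in expectation. Both properties together give
  the Karush-Kuhn-Tucker conditions, with multipliers the minimal marginal costs.\<close>

section \<open>Stationarity and the generator\<close>

text \<open>No path of the process is followed: inequalities valid in every state are integrated
  against the stationary law, and Markov's inequality leaves states that obey two deterministic
  bounds. The loss is small compared with \<open>r powr (1 + \<alpha>)\<close>, but the spread is
  only bounded by a multiple of \<open>r * sqrt r\<close>, so its constant has to be fixed before
  the loss is made small.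

  These orders dictate the second test function. A placement picks \<open>\<kappa>\<close> with
  probability at most \<open>X \<kappa> / agg X (cls \<kappa>)\<close>, and the factor
  \<open>agg X (cls \<kappa>)\<close> cancels the denominator. The square root has a derivative that
  blows up at 0: refilling a nearly empty \<open>\<kappa>\<close> gains about
  \<open>agg X (cls \<kappa>) / sqrt (X \<kappa>)\<close>, while depleting it comes with a factor
  \<open>X \<kappa>\<close> in its rate or probability, and \<open>y / sqrt y = sqrt y\<close> stays
  below the order \<open>sqrt r\<close>. All unfavourable terms thus add up to the order
  \<open>r * sqrt r\<close>, which the gain would exceed if \<open>\<kappa>\<close> were
  negligible.\<close>

lemma kernel_power_bound:
  fixes A :: real
  assumes "finite S" "\<And>u v. u \<in> S \<Longrightarrow> v \<in> S \<Longrightarrow> \<bar>G u v\<bar> \<le> A" "x \<in> S" "y \<in> S"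
  shows "\<bar>kernel_power S G m x y\<bar> \<le> (real (card S) * A) ^ m"
  using assms(3)
proof (induction m arbitrary: x)
  case (Suc m)
  have "0 \<le> A" using assms(2)[OF Suc.prems Suc.prems] by linarith
  have "\<bar>kernel_power S G (Suc m) x y\<bar> \<le> (\<Sum>z\<in>S. \<bar>G x z * kernel_power S G m z y\<bar>)"
    by (simp add: sum_abs)
  also have "\<dots> \<le> (\<Sum>z\<in>S. A * (real (card S) * A) ^ m)"
    using Suc \<open>0 \<le> A\<close> assms(2) by (intro sum_mono) (auto simp: abs_mult intro!: mult_mono)
  finally show ?case by (simp add: mult.assoc)
qed simp

text \<open>Kernel powers grow at most geometrically, so the exponential series converges at
  \<open>t = 1\<close> and may be differentiated term by term at 0, where only the linear
  coefficient survives.\<close>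

lemma trans_prob_has_derivative:
  assumes "finite S" "x \<in> S" "y \<in> S"
  shows "((\<lambda>t. trans_prob S w t x y) has_real_derivative generator S w x y) (at 0)"
proof -
  let ?G = "generator S w"
  define c where "c m = kernel_power S ?G m x y / fact m" for m
  define A where "A = (\<Sum>u\<in>S. \<Sum>v\<in>S. \<bar>?G u v\<bar>)"
  have A: "\<bar>?G u v\<bar> \<le> A" if "u \<in> S" "v \<in> S" for u v
  proof -
    have "\<bar>?G u v\<bar> \<le> (\<Sum>v\<in>S. \<bar>?G u v\<bar>)"
      using assms(1) that by (intro member_le_sum) auto
    also have "\<dots> \<le> A"
      unfolding A_def using assms(1) that
      by (intro member_le_sum[where f = "\<lambda>u. \<Sum>v\<in>S. \<bar>?G u v\<bar>"]) (auto intro: sum_nonneg)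
    finally show ?thesis .
  qed
  have "summable (\<lambda>m. c m * 1 ^ m)"
  proof (rule summable_comparison_test')
    show "summable (\<lambda>m. inverse (fact m) * (real (card S) * A) ^ m)" by (rule summable_exp)
    show "norm (c m * 1 ^ m) \<le> inverse (fact m) * (real (card S) * A) ^ m" for m
      using kernel_power_bound[OF assms(1), of ?G A x y m] A assms
      by (simp add: c_def field_simps)
  qed
  then have "((\<lambda>t. \<Sum>m. c m * t ^ m) has_real_derivative (\<Sum>m. diffs c m * 0 ^ m)) (at 0)"
    by (rule termdiffs_strong) simp
  moreover have "(\<Sum>m. diffs c m * 0 ^ m) = ?G x y"
    unfolding powser_zero using assms by (simp add: diffs_def c_def if_distrib cong: if_cong)
  moreover have "(\<lambda>t. \<Sum>m. c m * t ^ m) = (\<lambda>t. trans_prob S w t x y)"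
    by (simp add: trans_prob_def c_def mult.commute)
  ultimately show ?thesis by simp
qed

lemma stationary_dist_balance:
  assumes "finite S" "stationary_dist S w \<pi>" "y \<in> S"
  shows "(\<Sum>x\<in>S. pmf \<pi> x * generator S w x y) = 0"
proof -
  have "((\<lambda>t. \<Sum>x\<in>S. pmf \<pi> x * trans_prob S w t x y) has_real_derivative
      (\<Sum>x\<in>S. pmf \<pi> x * generator S w x y)) (at 0)"
    by (rule DERIV_sum, rule DERIV_cmult) (use assms in \<open>auto intro: trans_prob_has_derivative\<close>)
  \<comment> \<open>Stationarity is available for \<open>t \<ge> 0\<close> only, so the two
    derivatives are compared as one-sided ones.\<close>
  then have D: "((\<lambda>t. \<Sum>x\<in>S. pmf \<pi> x * trans_prob S w t x y) has_real_derivative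
      (\<Sum>x\<in>S. pmf \<pi> x * generator S w x y)) (at 0 within {0..})"
    by (rule has_field_derivative_at_within)
  have eq: "(\<Sum>x\<in>S. pmf \<pi> x * trans_prob S w t x y) = pmf \<pi> y" if "t \<ge> 0" for t
    using assms that by (auto simp: stationary_dist_def)
  have "((\<lambda>_. pmf \<pi> y) has_real_derivative 0) (at 0 within {0..})"
    by simp
  then have "((\<lambda>t. \<Sum>x\<in>S. pmf \<pi> x * trans_prob S w t x y) has_real_derivative 0) (at 0 within {0..})"
    by (rule has_field_derivative_transform_within[where d = 1]) (simp_all add: eq)
  from tendsto_unique[OF _ D[unfolded has_field_derivative_iff] this[unfolded has_field_derivative_iff]]
  show ?thesis by (simp add: at_within_Ici_at_right)
qed

text \<open>The balance equations tested against \<open>f\<close>. Zero row sums of the generator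
  produce the differences \<open>f y - f x\<close>; the diagonal rates \<open>w x x\<close> drop out
  because their difference is 0.\<close>

lemma stationary_dist_drift:
  fixes f :: "'s \<Rightarrow> real"
  assumes "finite S" "stationary_dist S w \<pi>"
  shows "measure_pmf.expectation \<pi> (\<lambda>x. \<Sum>y\<in>S. w x y * (f y - f x)) = 0"
proof -
  have gen: "(\<Sum>y\<in>S. generator S w x y * f y) = (\<Sum>y\<in>S. w x y * (f y - f x))" if "x \<in> S" for x
  proof -
    have "(\<Sum>y\<in>S. generator S w x y * f y)
        = generator S w x x * f x + (\<Sum>y\<in>S-{x}. generator S w x y * f y)"
      using assms(1) that by (rule sum.remove)
    also have "\<dots> = (\<Sum>y\<in>S-{x}. w x y * (f y - f x))"
    proof -
      have "(\<Sum>y\<in>S-{x}. generator S w x y * f y) = (\<Sum>y\<in>S-{x}. w x y * f y)"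
        by (rule sum.cong) (auto simp: generator_def)
      then show ?thesis
        by (simp add: generator_def sum_distrib_right right_diff_distrib sum_subtractf)
    qed
    also have "\<dots> = (\<Sum>y\<in>S. w x y * (f y - f x))"
      using assms(1) that by (simp add: sum.remove[of S x])
    finally show ?thesis .
  qed
  have "measure_pmf.expectation \<pi> (\<lambda>x. \<Sum>y\<in>S. w x y * (f y - f x))
      = (\<Sum>x\<in>S. (\<Sum>y\<in>S. w x y * (f y - f x)) * pmf \<pi> x)"
    using assms by (intro integral_measure_pmf_real) (auto simp: stationary_dist_def)
  also have "\<dots> = (\<Sum>x\<in>S. \<Sum>y\<in>S. pmf \<pi> x * generator S w x y * f y)"
    by (simp add: gen[symmetric] sum_distrib_left sum_distrib_right mult_ac)
  also have "\<dots> = (\<Sum>y\<in>S. (\<Sum>x\<in>S. pmf \<pi> x * generator S w x y) * f y)"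
    by (subst sum.swap) (simp add: sum_distrib_right)
  also have "\<dots> = 0"
    by (simp add: stationary_dist_balance[OF assms])
  finally show ?thesis .
qed

section \<open>Configurations\<close>

lemma add_del_cust: "k i > 0 \<Longrightarrow> add_cust i (del_cust i k) = k"
  by (auto simp: add_cust_def del_cust_def)

lemma add_cust_neq_empty [simp]: "add_cust i k \<noteq> empty_config"
  by (auto simp: add_cust_def empty_config_def fun_eq_iff)

lemma del_cust_neq: "k i > 0 \<Longrightarrow> del_cust i k \<noteq> k"
  by (auto simp: del_cust_def fun_eq_iff)

lemma usage_del_cust:
  assumes "k i > 0"
  shows "usage b k n = usage b (del_cust i k) n + b i n"
  using usage_add_cust[of b i "del_cust i k" n] add_del_cust[where k = k and i = i] assms by simp

lemma neq_empty_configE: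
  assumes "k \<noteq> empty_config" obtains i where "k i > 0"
  using assms by (auto simp: empty_config_def fun_eq_iff)

lemma sum_add_cust:
  fixes c :: "'i::finite \<Rightarrow> real"
  shows "(\<Sum>j\<in>UNIV. real (add_cust i k j) * c j) = (\<Sum>j\<in>UNIV. real (k j) * c j) + c i"
  using usage_add_cust[of "\<lambda>i _. c i" i k] by (simp add: usage_def)

lemma sum_del_cust:
  fixes c :: "'i::finite \<Rightarrow> real"
  assumes "k i > 0"
  shows "(\<Sum>j\<in>UNIV. real (k j) * c j) = (\<Sum>j\<in>UNIV. real (del_cust i k j) * c j) + c i"
  using sum_add_cust[of i "del_cust i k" c] add_del_cust[where k = k and i = i] assms by simp

locale packing =
  fixes B :: "'n::finite \<Rightarrow> real" and b :: "'i::finite \<Rightarrow> 'n \<Rightarrow> real"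
  assumes b_pos: "b i n > 0"
    and unit_fits: "add_cust i empty_config \<in> configs0 B b"
begin

definition cls :: "'i config \<Rightarrow> 'i aconf" where
  "cls k = conf_equiv B b `` {k}"

lemma b_nonneg: "0 \<le> b i n"
  using b_pos[of i n] by simp

lemma usage_nonneg: "usage b k n \<ge> 0"
  unfolding usage_def by (intro sum_nonneg mult_nonneg_nonneg b_nonneg) simp

lemma usage_empty [simp]: "usage b empty_config n = 0"
  by (simp add: usage_def empty_config_def)

lemma empty_in_configs0 [simp]: "empty_config \<in> configs0 B b"
proof -
  have "0 \<le> B n" for n
    using unit_fits[of undefined] b_pos[of undefined n] by (auto simp: configs0_def usage_add_cust dest: spec[of _ n])
  then show ?thesis by (simp add: configs0_def)
qed

lemma empty_notin_configs [simp]: "empty_config \<notin> configs B b"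
  by (simp add: configs_def)

lemma usage_pos:
  assumes "k \<noteq> empty_config" shows "usage b k n > 0"
proof -
  obtain i where "k i > 0" using neq_empty_configE[OF assms] .
  then show ?thesis
    using usage_del_cust[where k = k and i = i and b = b and n = n] usage_nonneg[of "del_cust i k" n] b_pos[of i n] by linarith
qed

lemma finite_configs0: "finite (configs0 B b)"
proof -
  \<comment> \<open>One arbitrary resource bounds every coordinate, since each customer needs a
    positive amount of it.\<close>
  fix n :: 'n
  define N where "N i = nat \<lfloor>B n / b i n\<rfloor>" for i
  have "configs0 B b \<subseteq> (\<Pi>\<^sub>E i\<in>UNIV. {..N i})"
  proof
    fix k assume k: "k \<in> configs0 B b"
    have "k i \<le> N i" for i
    proof -
      have "real (k i) * b i n \<le> usage b k n"
        unfolding usage_def by (intro member_le_sum) (auto intro!: mult_nonneg_nonneg b_nonneg)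
      also have "\<dots> \<le> B n" using k by (simp add: configs0_def)
      finally have "real (k i) \<le> B n / b i n" using b_pos[of i n] by (simp add: field_simps)
      then show ?thesis unfolding N_def by linarith
    qed
    then show "k \<in> (\<Pi>\<^sub>E i\<in>UNIV. {..N i})" by auto
  qed
  then show ?thesis by (rule finite_subset) (auto intro: finite_PiE)
qed

lemma finite_configs [simp]: "finite (configs B b)"
  using finite_configs0 by (simp add: configs_def)

lemma del_cust_in_configs0:
  assumes "k \<in> configs0 B b" "k i > 0" shows "del_cust i k \<in> configs0 B b"
proof -
  have "usage b (del_cust i k) n \<le> B n" for n
    using assms usage_del_cust[where k = k and i = i and b = b and n = n] b_pos[of i n]
    by (auto simp: configs0_def dest: spec[of _ n])
  then show ?thesis by (simp add: configs0_def)
qed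

lemma in_cls_iff:
  "k \<in> configs0 B b \<Longrightarrow> k' \<in> cls k \<longleftrightarrow> k' \<in> configs0 B b \<and> (\<forall>n. usage b k n = usage b k' n)"
  by (auto simp: cls_def conf_equiv_def)

lemma cls_self: "k \<in> configs0 B b \<Longrightarrow> k \<in> cls k"
  by (simp add: in_cls_iff)

lemma cls_in_aconfs0: "k \<in> configs0 B b \<Longrightarrow> cls k \<in> aconfs0 B b"
  by (auto simp: cls_def aconfs0_def intro: quotientI)

lemma aconfs0_cls: "q \<in> aconfs0 B b \<Longrightarrow> k \<in> q \<Longrightarrow> q = cls k"
  unfolding aconfs0_def cls_def by (metis Image_singleton_iff equiv_conf_equiv equiv_class_eq quotientE)

lemma aconfs0_subset: "q \<in> aconfs0 B b \<Longrightarrow> q \<subseteq> configs0 B b"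
  unfolding aconfs0_def using in_quotient_imp_subset[OF equiv_conf_equiv] .

lemma empty_aconf_eq: "empty_aconf B b = cls empty_config"
  by (simp add: empty_aconf_def cls_def)

text \<open>A nonzero configuration uses a positive amount of each resource, hence cannot be
  equivalent to the empty one.\<close>

lemma cls_empty: "cls empty_config = {empty_config}"
  using usage_pos by (auto simp: in_cls_iff) (metis less_irrefl)

lemma aconfs_iff: "q \<in> aconfs B b \<longleftrightarrow> q \<in> aconfs0 B b \<and> empty_config \<notin> q"
  using aconfs0_cls cls_self cls_empty by (auto simp: aconfs_def empty_aconf_eq)

lemma aconfs_subset: "q \<in> aconfs B b \<Longrightarrow> q \<subseteq> configs B b"
  using aconfs0_subset by (auto simp: aconfs_iff configs_def)

lemma cls_in_aconfs: "k \<in> configs B b \<Longrightarrow> cls k \<in> aconfs B b"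
  using cls_in_aconfs0[of k] aconfs0_cls[of "cls k" empty_config] cls_self[of k] cls_empty
  by (auto simp: aconfs_iff configs_def)

lemma finite_aconf: "q \<in> aconfs0 B b \<Longrightarrow> finite q"
  using aconfs0_subset finite_configs0 finite_subset by blast

lemma finite_aconfs [simp]: "finite (aconfs B b)"
  using aconfs_subset finite_configs by (meson Pow_iff finite_Pow_iff finite_subset subsetI)

text \<open>The classes partition the configurations. This rewrites linear forms whose coefficients
  are constant on classes, such as the gradient of \<open>\<Phi>\<close>.\<close>

lemma sum_configs_cls:
  fixes s :: "'i aconf \<Rightarrow> real"
  shows "(\<Sum>k\<in>configs B b. s (cls k) * y k) = (\<Sum>q\<in>aconfs B b. s q * agg y q)"
proof -
  have "(\<Sum>k\<in>configs B b. s (cls k) * y k)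
      = (\<Sum>q\<in>aconfs B b. \<Sum>k\<in>{k\<in>configs B b. cls k = q}. s (cls k) * y k)"
    by (rule sum.group[symmetric]) (auto simp: cls_in_aconfs)
  also have "\<dots> = (\<Sum>q\<in>aconfs B b. s q * agg y q)"
  proof (rule sum.cong[OF refl])
    fix q assume q: "q \<in> aconfs B b"
    have "{k\<in>configs B b. cls k = q} = q"
      using q aconfs_subset[OF q] aconfs0_cls[of q] cls_self by (auto simp: aconfs_iff configs_def)
    then show "(\<Sum>k\<in>{k\<in>configs B b. cls k = q}. s (cls k) * y k) = s q * agg y q"
      by (simp add: agg_def sum_distrib_left) (rule sum.cong, auto)
  qed
  finally show ?thesis .
qed

end

section \<open>Optimality conditions\<close>

lemma sum_del_cust_less:
  fixes k :: "'i::finite config"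
  assumes "k i > 0" shows "sum (del_cust i k) UNIV < sum k UNIV"
  using assms by (intro sum_strict_mono_ex1) (auto simp: del_cust_def)

lemma sum_mult_pos:
  fixes k :: "'i::finite config" and m :: "'i \<Rightarrow> real"
  assumes "k \<noteq> empty_config" "\<And>i. k i > 0 \<Longrightarrow> m i > 0"
  shows "(\<Sum>i\<in>UNIV. real (k i) * m i) > 0"
proof -
  obtain i where "k i > 0" using neq_empty_configE[OF assms(1)] .
  moreover have "real (k j) * m j \<ge> 0" for j
    using assms(2)[of j] by (cases "k j = 0") auto
  ultimately show ?thesis
    using assms(2) by (intro sum_pos2[where i = i]) auto
qed

lemma del_cust_pos: "del_cust i k j > 0 \<Longrightarrow> k j > 0"
  by (auto simp: del_cust_def split: if_splits)

text \<open>The tangent inequality for the convex function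
  \<open>u powr (1 + \<alpha>) / (1 + \<alpha>)\<close>. Young's inequality with exponents
  \<open>1 + \<alpha>\<close> and \<open>(1 + \<alpha>) / \<alpha>\<close> yields it without
  derivatives, so the boundary point \<open>u = 0\<close> is no special case.\<close>

lemma powr_Suc_gradient:
  fixes u v \<alpha> :: real
  assumes "u \<ge> 0" "v \<ge> 0" "\<alpha> > 0"
  shows "u powr \<alpha> * (v - u) \<le> inverse (1 + \<alpha>) * v powr (1 + \<alpha>) - inverse (1 + \<alpha>) * u powr (1 + \<alpha>)"
proof -
  have "v * u powr \<alpha> \<le> v powr (1 + \<alpha>) / (1 + \<alpha>) + (u powr \<alpha>) powr ((1 + \<alpha>) / \<alpha>) / ((1 + \<alpha>) / \<alpha>)"
    using assms by (intro Youngs_inequality) (auto simp: field_simps)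
  moreover have "(u powr \<alpha>) powr ((1 + \<alpha>) / \<alpha>) = u powr (1 + \<alpha>)"
    using assms by (simp add: powr_powr)
  moreover have "u powr \<alpha> * u = u powr (1 + \<alpha>)"
    using assms by (simp add: powr_add mult.commute)
  moreover have "u powr (1 + \<alpha>) / ((1 + \<alpha>) / \<alpha>) = u powr (1 + \<alpha>) - inverse (1 + \<alpha>) * u powr (1 + \<alpha>)"
    using assms by (simp add: field_simps)
  ultimately show ?thesis
    by (simp add: algebra_simps divide_inverse)
qed

context packing
begin

text \<open>The induction removes a customer type of nonpositive multiplier first. Then either the
  multipliers of the remaining configuration sum to something positive, so that by induction
  it is occupied and the step condition applies, or there is nothing to prove.\<close>

lemma dual_feasible:
  fixes S :: "'i config \<Rightarrow> real" and m :: "'i \<Rightarrow> real"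
  assumes nonneg: "\<And>k. S k \<ge> 0"
    and step: "\<And>k i. k \<in> configs0 B b \<Longrightarrow> add_cust i k \<in> configs0 B b \<Longrightarrow>
                 k = empty_config \<or> S k > 0 \<Longrightarrow> m i \<le> S (add_cust i k) - S k"
    and "k \<in> configs0 B b"
  shows "(\<Sum>i\<in>UNIV. real (k i) * m i) \<le> S k"
  using assms(3)
proof (induction "sum k UNIV" arbitrary: k rule: less_induct)
  case less
  let ?m = "\<lambda>k. \<Sum>i\<in>UNIV. real (k i) * m i"
  show ?case
  proof (cases "?m k \<le> 0")
    case True
    then show ?thesis using nonneg[of k] by linarith
  next
    case False
    have "\<exists>i. k i > 0 \<and> (del_cust i k = empty_config \<or> ?m (del_cust i k) > 0)"
    proof (cases "\<exists>i. k i > 0 \<and> m i \<le> 0")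
      case True
      then obtain i where "k i > 0" "m i \<le> 0" by blast
      then show ?thesis using False sum_del_cust[where k = k and i = i and c = m] by force
    next
      case nn: False
      have "k \<noteq> empty_config" using False by (auto simp: empty_config_def)
      then obtain i where i: "k i > 0" by (rule neq_empty_configE)
      have "m j > 0" if "k j > 0" for j
        using nn that by (meson not_le)
      then have "?m (del_cust i k) > 0" if "del_cust i k \<noteq> empty_config"
        using that del_cust_pos[of i k] by (intro sum_mult_pos) simp_all
      then show ?thesis using i by blast
    qed
    then obtain i where i: "k i > 0" "del_cust i k = empty_config \<or> ?m (del_cust i k) > 0"
      by blast
    have IH: "?m (del_cust i k) \<le> S (del_cust i k)"
      using sum_del_cust_less[where k = k and i = i] del_cust_in_configs0[OF less.prems] i(1)
      by (intro less.hyps) simp_all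
    have "m i \<le> S k - S (del_cust i k)"
      using step[of "del_cust i k" i] less.prems i IH del_cust_in_configs0[OF less.prems i(1)]
        add_del_cust[where k = k and i = i] by auto
    then show ?thesis
      using sum_del_cust[where k = k and i = i and c = m] i IH by linarith
  qed
qed

text \<open>Induction on the number of customers. If some removal leaves the empty configuration or
  one with \<open>S\<close> positive, then \<open>spread\<close> makes a nonempty remainder itself
  occupied, and the induction hypothesis applies to it. Otherwise \<open>step\<close> forces every
  multiplier occurring in \<open>k\<close> to be at least \<open>S k > 0\<close>; then
  \<open>dual\<close> makes \<open>S\<close> positive on a remainder, a contradiction.\<close>

lemma complementary_slackness:
  fixes S x :: "'i config \<Rightarrow> real" and m :: "'i \<Rightarrow> real"
  assumes dual: "\<And>k. k \<in> configs0 B b \<Longrightarrow> (\<Sum>i\<in>UNIV. real (k i) * m i) \<le> S k"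
    and S_empty: "S empty_config = 0"
    and pos: "\<And>k. k \<in> configs B b \<Longrightarrow> x k > 0 \<Longrightarrow> S k > 0"
    and step: "\<And>k i. k \<in> configs B b \<Longrightarrow> x k > 0 \<Longrightarrow> k i > 0 \<Longrightarrow> S k \<le> S (del_cust i k) + m i"
    and spread: "\<And>k i. k \<in> configs B b \<Longrightarrow> x k > 0 \<Longrightarrow> k i > 0 \<Longrightarrow> S (del_cust i k) > 0 \<Longrightarrow>
                   x (del_cust i k) > 0"
    and "k \<in> configs B b" "x k > 0"
  shows "S k \<le> (\<Sum>i\<in>UNIV. real (k i) * m i)"
  using assms(6,7)
proof (induction "sum k UNIV" arbitrary: k rule: less_induct)
  case less
  let ?m = "\<lambda>k. \<Sum>i\<in>UNIV. real (k i) * m i"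
  have del: "del_cust i k \<in> configs0 B b" if "k i > 0" for i
    using that less.prems del_cust_in_configs0 by (auto simp: configs_def)
  show ?case
  proof (cases "\<exists>i. k i > 0 \<and> (del_cust i k = empty_config \<or> S (del_cust i k) > 0)")
    case True
    then obtain i where i: "k i > 0" "del_cust i k = empty_config \<or> S (del_cust i k) > 0"
      by blast
    have "S (del_cust i k) \<le> ?m (del_cust i k)"
    proof (cases "del_cust i k = empty_config")
      case True
      then show ?thesis by (simp add: S_empty empty_config_def[symmetric]) (simp add: empty_config_def)
    next
      case False
      then show ?thesis
        using less i spread del[OF i(1)] sum_del_cust_less[where k = k and i = i]
        by (auto simp: configs_def)
    qed
    then show ?thesis
      using step[OF less.prems i(1)] sum_del_cust[where k = k and i = i and c = m] i by linarith
  next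
    case False
    have "k \<noteq> empty_config" using less.prems by auto
    then obtain i where i: "k i > 0" by (rule neq_empty_configE)
    have "m j > 0" if "k j > 0" for j
    proof -
      have "\<not> S (del_cust j k) > 0" using False that by blast
      then show ?thesis using step[OF less.prems that] pos[OF less.prems] by linarith
    qed
    moreover have "del_cust i k \<noteq> empty_config" using False i by blast
    ultimately have "?m (del_cust i k) > 0"
      using del_cust_pos[of i k] by (intro sum_mult_pos) simp_all
    then have "S (del_cust i k) > 0" using dual[OF del[OF i]] by linarith
    then show ?thesis using False i by blast
  qed
qed

lemma agg_nonneg: "x \<in> feasible B b \<rho> \<Longrightarrow> q \<in> aconfs B b \<Longrightarrow> agg x q \<ge> 0"
  unfolding agg_def feasible_def using aconfs_subset by (intro sum_nonneg) blast

text \<open>Weighted by the multipliers, all feasible vectors have the same total. So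
  \<open>dual\<close> and \<open>slack\<close> bound the inner product of the gradient at
  \<open>x\<close> with \<open>x\<close> by its inner product with any feasible \<open>y\<close>,
  and convexity of \<open>\<Phi>\<close> concludes.\<close>

lemma optimal_of_KKT:
  assumes "\<alpha> > 0" "x \<in> feasible B b \<rho>"
    and dual: "\<And>k. k \<in> configs B b \<Longrightarrow> (\<Sum>i\<in>UNIV. real (k i) * m i) \<le> agg x (cls k) powr \<alpha>"
    and slack: "\<And>k. k \<in> configs B b \<Longrightarrow> x k > 0 \<Longrightarrow>
                  agg x (cls k) powr \<alpha> \<le> (\<Sum>i\<in>UNIV. real (k i) * m i)"
  shows "x \<in> optimal B b \<rho> \<alpha>"
proof -
  let ?m = "\<lambda>k. \<Sum>i\<in>UNIV. real (k i) * m i"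
  have total: "(\<Sum>k\<in>configs B b. ?m k * y k) = (\<Sum>i\<in>UNIV. m i * \<rho> i)"
    if "y \<in> feasible B b \<rho>" for y
  proof -
    have "(\<Sum>k\<in>configs B b. ?m k * y k)
        = (\<Sum>i\<in>UNIV. m i * (\<Sum>k\<in>configs B b. real (k i) * y k))"
      unfolding sum_distrib_left sum_distrib_right by (subst sum.swap) (simp add: mult_ac)
    then show ?thesis using that by (simp add: feasible_def)
  qed
  have "\<Phi> B b \<alpha> x \<le> \<Phi> B b \<alpha> y" if y: "y \<in> feasible B b \<rho>" for y
  proof -
    have "(\<Sum>k\<in>configs B b. agg x (cls k) powr \<alpha> * x k) \<le> (\<Sum>k\<in>configs B b. ?m k * x k)"
    proof (rule sum_mono)
      fix k assume k: "k \<in> configs B b"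
      with assms(2) have "x k \<ge> 0" by (simp add: feasible_def)
      then show "agg x (cls k) powr \<alpha> * x k \<le> ?m k * x k"
        using slack[OF k] by (cases "x k = 0") (auto intro!: mult_right_mono)
    qed
    also have "\<dots> = (\<Sum>k\<in>configs B b. ?m k * y k)"
      by (simp only: total y assms(2))
    also have "\<dots> \<le> (\<Sum>k\<in>configs B b. agg x (cls k) powr \<alpha> * y k)"
      using dual y by (intro sum_mono mult_right_mono) (auto simp: feasible_def)
    finally have "0 \<le> (\<Sum>q\<in>aconfs B b. agg x q powr \<alpha> * (agg y q - agg x q))"
      unfolding sum_configs_cls[where s = "\<lambda>q. agg x q powr \<alpha>"]
      by (simp add: right_diff_distrib sum_subtractf)
    also have "\<dots> \<le> \<Phi> B b \<alpha> y - \<Phi> B b \<alpha> x"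
      unfolding \<Phi>_def sum_subtractf[symmetric]
      by (intro sum_mono powr_Suc_gradient) (use agg_nonneg assms y in auto)
    finally show ?thesis by simp
  qed
  then show ?thesis
    using assms(2) by (auto simp: optimal_def is_arg_min_def not_less)
qed

text \<open>The multiplier \<open>m i\<close> is the least marginal cost of type \<open>i\<close>
  over the empty configuration and all configurations in occupied classes. Minimality gives dual
  feasibility, and \<open>greedy\<close> bounds the marginal costs in occupied configurations by
  \<open>m i\<close>. Since \<open>m i\<close> sees only classes, \<open>spread\<close> is needed to
  descend to single configurations.\<close>

lemma optimalI:
  assumes "\<alpha> > 0" "x \<in> feasible B b \<rho>"
    and greedy: "\<And>k i k'. k \<in> configs B b \<Longrightarrow> x k > 0 \<Longrightarrow> k i > 0 \<Longrightarrow>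
        k' \<in> configs0 B b \<Longrightarrow> add_cust i k' \<in> configs0 B b \<Longrightarrow>
        k' = empty_config \<or> agg x (cls k') > 0 \<Longrightarrow>
        agg x (cls k) powr \<alpha> - agg x (cls (del_cust i k)) powr \<alpha>
          \<le> agg x (cls (add_cust i k')) powr \<alpha> - agg x (cls k') powr \<alpha>"
    and spread: "\<And>k i. k \<in> configs B b \<Longrightarrow> x k > 0 \<Longrightarrow> k i > 0 \<Longrightarrow> del_cust i k \<noteq> empty_config \<Longrightarrow>
        agg x (cls (del_cust i k)) > 0 \<Longrightarrow> x (del_cust i k) > 0"
  shows "x \<in> optimal B b \<rho> \<alpha>"
proof -
  define S where "S k = agg x (cls k) powr \<alpha>" for k
  have x0: "x k \<ge> 0" for k
    using assms(2) by (cases "k \<in> configs B b") (auto simp: feasible_def)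
  have agg0: "agg x q \<ge> 0" for q
    unfolding agg_def by (intro sum_nonneg x0)
  have S_pos: "S k > 0 \<longleftrightarrow> agg x (cls k) > 0" for k
    using agg0[of "cls k"] by (auto simp: S_def)
  have S_empty: "S empty_config = 0"
    using assms(2) by (simp add: S_def cls_empty agg_def feasible_def)
  define A where "A i = {k. k \<in> configs0 B b \<and> add_cust i k \<in> configs0 B b \<and>
                    (k = empty_config \<or> S k > 0)}" for i
  define m where "m i = Min ((\<lambda>k. S (add_cust i k) - S k) ` A i)" for i
  have fin: "finite (A i)" for i
    using finite_configs0 by (auto simp: A_def)
  \<comment> \<open>An empty server always accepts the customer, so the minimum is over a nonempty
    set.\<close>
  have ne: "A i \<noteq> {}" for i
    using unit_fits by (auto simp: A_def intro!: exI[of _ empty_config])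
  have m_le: "m i \<le> S (add_cust i k) - S k" if "k \<in> A i" for i k
    unfolding m_def using that fin by (intro Min_le) auto
  have le_m: "c \<le> m i" if "\<And>k. k \<in> A i \<Longrightarrow> c \<le> S (add_cust i k) - S k" for c i
    unfolding m_def using that fin ne by (subst Min_ge_iff) auto
  have dual: "(\<Sum>i\<in>UNIV. real (k i) * m i) \<le> S k" if "k \<in> configs0 B b" for k
    using that by (intro dual_feasible m_le) (auto simp: S_def A_def)
  have pos: "S k > 0" if "k \<in> configs B b" "x k > 0" for k
  proof -
    have "k \<in> configs0 B b" using that by (simp add: configs_def)
    then have "x k \<le> agg x (cls k)"
      unfolding agg_def using finite_aconf[OF cls_in_aconfs0] cls_self
      by (intro member_le_sum x0) auto
    then show ?thesis using that S_pos by simp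
  qed
  have "S k \<le> (\<Sum>i\<in>UNIV. real (k i) * m i)" if "k \<in> configs B b" "x k > 0" for k
  proof (rule complementary_slackness[where S = S and x = x and m = m, OF dual S_empty pos _ _ that])
    fix k i assume k: "k \<in> configs B b" "x k > 0" "k i > 0"
    have "S k - S (del_cust i k) \<le> m i"
      by (rule le_m) (use greedy[OF k] in \<open>auto simp: A_def S_pos S_def[symmetric]\<close>)
    then show "S k \<le> S (del_cust i k) + m i" by simp
    show "x (del_cust i k) > 0" if "S (del_cust i k) > 0"
      using spread[OF k] that S_empty
      by (cases "del_cust i k = empty_config") (auto simp: S_pos[symmetric])
  qed
  then show ?thesis
    using dual by (intro optimal_of_KKT[OF assms(1,2), of m]) (auto simp: S_def configs_def)
qed

end

section \<open>Transitions\<close>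

text \<open>With the source server present, the truncated subtraction of the definition is exact, so
  the change can be written over the reals. Empty servers are not counted, hence
  \<open>j \<noteq> empty_config\<close>.\<close>

lemma change_server_apply:
  assumes "k = empty_config \<or> X k > 0" "j \<noteq> empty_config"
  shows "real (change_server k k' X j) = real (X j) - of_bool (j = k) + of_bool (j = k')"
  using assms by (auto simp: change_server_def Let_def of_nat_diff)

lemma change_server_empty [simp]: "change_server k k' X empty_config = X empty_config"
  by (auto simp: change_server_def Let_def)

lemma change_server_back:
  assumes "k = empty_config \<or> X k > 0" "k \<noteq> k'"
  shows "change_server k' k (change_server k k' X) = X"
proof
  fix j show "change_server k' k (change_server k k' X) j = X j"
    using assms by (cases "k = empty_config"; cases "k' = empty_config"; cases "j = k"; cases "j = k'")
      (simp_all add: change_server_def)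
qed

lemma change_server_avail:
  "k \<noteq> k' \<Longrightarrow> k' = empty_config \<or> change_server k k' X k' > 0"
  by (auto simp: change_server_def Let_def)

lemma sum_change_server:
  fixes c :: "'i config \<Rightarrow> real"
  assumes "finite A" "empty_config \<notin> A" "k = empty_config \<or> X k > 0"
  shows "(\<Sum>j\<in>A. c j * real (change_server k k' X j))
       = (\<Sum>j\<in>A. c j * real (X j)) - (if k \<in> A then c k else 0) + (if k' \<in> A then c k' else 0)"
proof -
  have "(\<Sum>j\<in>A. c j * real (change_server k k' X j))
      = (\<Sum>j\<in>A. c j * real (X j) - (if j = k then c j else 0) + (if j = k' then c j else 0))"
  proof (rule sum.cong[OF refl])
    fix j assume "j \<in> A"
    then have "j \<noteq> empty_config" using assms(2) by blast
    then show "c j * real (change_server k k' X j)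
        = c j * real (X j) - (if j = k then c j else 0) + (if j = k' then c j else 0)"
      by (simp add: change_server_apply[where X = X and k = k, OF assms(3)] algebra_simps)
  qed
  then show ?thesis
    using assms(1) by (simp add: sum.distrib sum_subtractf)
qed

context packing
begin

lemma agg_change_server:
  assumes "q \<in> aconfs B b" "k = empty_config \<or> X k > 0"
  shows "real (agg (change_server k k' X) q) = real (agg X q) - of_bool (k \<in> q) + of_bool (k' \<in> q)"
  using sum_change_server[of q k X "\<lambda>_. 1" k'] assms finite_aconf
  by (auto simp: aconfs_iff agg_def)

lemma cls_eq_iff: "q \<in> aconfs0 B b \<Longrightarrow> k \<in> configs0 B b \<Longrightarrow> k \<in> q \<longleftrightarrow> q = cls k"
  using aconfs0_cls cls_self by blast

lemma cls_add_cust_neq: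
  assumes "k \<in> configs0 B b" shows "cls (add_cust i k) \<noteq> cls k"
proof
  assume "cls (add_cust i k) = cls k"
  with cls_self[OF assms] have "k \<in> cls (add_cust i k)" by simp
  then have "(add_cust i k, k) \<in> conf_equiv B b" by (simp add: cls_def)
  then have "usage b (add_cust i k) n = usage b k n" for n
    by (simp add: conf_equiv_def)
  then show False
    using b_pos[of i] by (simp add: usage_add_cust less_imp_neq[symmetric])
qed

lemma configs_neq_empty: "k \<in> configs B b \<Longrightarrow> k \<noteq> empty_config"
  by auto

lemma configs_configs0: "k \<in> configs B b \<Longrightarrow> k \<in> configs0 B b"
  by (simp add: configs_def)

lemma add_cust_configs: "add_cust i k \<in> configs0 B b \<Longrightarrow> add_cust i k \<in> configs B b"
  by (simp add: configs_def)

lemma add_aconf_cls: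
  assumes "k \<in> configs0 B b" "add_cust i k \<in> configs0 B b"
  shows "can_add B b i (cls k)" "add_aconf B b i (cls k) = cls (add_cust i k)"
proof -
  show *: "can_add B b i (cls k)"
    using assms cls_in_aconfs0 cls_self by (subst can_add_iff) auto
  show "add_aconf B b i (cls k) = cls (add_cust i k)"
    using add_aconf_eq[OF cls_in_aconfs0 cls_self *] assms by (simp add: cls_def)
qed

lemma placeable_cls:
  assumes "k \<in> configs0 B b" "add_cust i k \<in> configs0 B b" "k = empty_config \<or> X k > 0"
  shows "placeable B b X i (cls k)"
proof -
  have "agg X (cls k) > 0" if "X k > 0"
  proof -
    have "X k \<le> agg X (cls k)"
      unfolding agg_def using assms finite_aconf[OF cls_in_aconfs0] cls_self
      by (intro member_le_sum) auto
    then show ?thesis using that by simp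
  qed
  then show ?thesis
    using assms(3) add_aconf_cls(1)[OF assms(1,2)] cls_in_aconfs0[OF assms(1)]
    unfolding placeable_def empty_aconf_eq by metis
qed

lemma set_server_pmf:
  assumes "placeable B b X i q" "k \<in> set_pmf (server_pmf B b X q)"
  shows "k \<in> q" "k = empty_config \<or> X k > 0"
proof -
  have "k \<in> q \<and> (k = empty_config \<or> X k > 0)"
  proof (cases "q = empty_aconf B b")
    case True
    then show ?thesis using assms by (simp add: server_pmf_def empty_aconf_eq cls_empty)
  next
    case False
    then have q: "q \<in> aconfs0 B b" "agg X q > 0"
      using assms by (auto simp: placeable_def)
    have "finite (SIGMA k:q. {..<X k})" using finite_aconf[OF q(1)] by auto
    moreover have "(SIGMA k:q. {..<X k}) \<noteq> {}"
    proof -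
      have "sum X q \<noteq> 0" using q(2) by (simp add: agg_def)
      then obtain k0 where "k0 \<in> q" "X k0 \<noteq> 0"
        by (rule sum.not_neutral_contains_not_neutral)
      then have "(k0, 0) \<in> (SIGMA k:q. {..<X k})" by simp
      then show ?thesis by blast
    qed
    ultimately have "set_pmf (server_pmf B b X q) = fst ` (SIGMA k:q. {..<X k})"
      using False by (simp add: server_pmf_def set_pmf_of_set)
    then show ?thesis using assms(2) by auto
  qed
  then show "k \<in> q" "k = empty_config \<or> X k > 0" by auto
qed

text \<open>If \<open>q\<close> is the class of \<open>k\<close>, the uniform choice gives equality;
  otherwise \<open>k\<close> is never selected. The product form covers both cases and avoids
  dividing by an aggregate count that may be 0. Through this bound the uniform choice enters the
  spread estimate.\<close>

lemma pmf_server_pmf_le: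
  assumes "placeable B b X i q" "k \<noteq> empty_config" "k \<in> configs0 B b"
  shows "pmf (server_pmf B b X q) k * real (agg X (cls k)) \<le> real (X k)"
proof (cases "q = cls k")
  case False
  then have "k \<notin> q" using assms aconfs0_cls[of q k] by (auto simp: placeable_def)
  then have "k \<notin> set_pmf (server_pmf B b X q)" using set_server_pmf[OF assms(1)] by blast
  then show ?thesis by (simp add: set_pmf_iff)
next
  case True
  then have kq: "k \<in> q" using cls_self[OF assms(3)] by simp
  have ne: "q \<noteq> empty_aconf B b"
    using kq assms(2) by (auto simp: empty_aconf_eq cls_empty)
  then have q: "q \<in> aconfs0 B b" "agg X q > 0"
    using assms by (auto simp: placeable_def)
  let ?A = "SIGMA k:q. {..<X k}"
  have fin: "finite ?A" using finite_aconf[OF q(1)] by auto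
  have card: "card ?A = agg X q" using finite_aconf[OF q(1)] by (simp add: agg_def)
  then have nemp: "?A \<noteq> {}" using q(2) by (metis card.empty less_irrefl)
  have "?A \<inter> fst -` {k} = {k} \<times> {..<X k}" using kq by auto
  then have "pmf (server_pmf B b X q) k = real (X k) / real (agg X q)"
    using fin nemp ne
    by (simp add: server_pmf_def pmf_map measure_pmf_of_set card card_cartesian_product)
  then show ?thesis using True q by simp
qed

end

lemma expectation_ge_const:
  fixes f :: "'a \<Rightarrow> real"
  assumes "finite (set_pmf p)" "\<And>y. y \<in> set_pmf p \<Longrightarrow> c \<le> f y"
  shows "c \<le> measure_pmf.expectation p f"
proof -
  have "c = measure_pmf.expectation p (\<lambda>_. c)" by simp
  also have "\<dots> \<le> measure_pmf.expectation p f"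
    using assms by (intro integral_mono_AE) (auto simp: AE_measure_pmf_iff intro: integrable_measure_pmf_finite)
  finally show ?thesis .
qed

section \<open>The closed system and its drift operator\<close>

locale greedy_system = packing B b
  for B :: "'n::finite \<Rightarrow> real" and b :: "'i::finite \<Rightarrow> 'n \<Rightarrow> real" +
  fixes \<mu> \<rho> :: "'i \<Rightarrow> real" and \<alpha> r :: real and sel :: "'i \<Rightarrow> 'i state \<Rightarrow> 'i aconf"
  assumes mu_pos: "\<mu> i > 0" and sum_rho: "(\<Sum>i\<in>UNIV. \<rho> i) = 1"
    and alpha_pos: "\<alpha> > 0" and r_ge_1: "r \<ge> 1"
    and greedy: "greedy_rule B b \<alpha> sel"
begin

abbreviation states :: "'i state set" where
  "states \<equiv> closed_states B b \<rho> r"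

abbreviation depart :: "'i config \<Rightarrow> 'i \<Rightarrow> 'i state \<Rightarrow> 'i state" where
  "depart k i X \<equiv> change_server k (del_cust i k) X"

text \<open>Scaled by \<open>r\<close>, this is the total service rate; it is the same in every
  state because the customers of each type are conserved.\<close>

definition \<Lambda> :: real where
  "\<Lambda> = (\<Sum>i\<in>UNIV. \<mu> i * \<rho> i)"

text \<open>The generator of the closed chain applied to \<open>f\<close>, organized by departures
  instead of target states, so that a departure and the placement following it can be estimated
  separately.\<close>

definition drift :: "('i state \<Rightarrow> real) \<Rightarrow> 'i state \<Rightarrow> real" where
  "drift f X = (\<Sum>k\<in>configs B b. \<Sum>i\<in>UNIV. \<mu> i * real (k i) * real (X k) *
     (measure_pmf.expectation (placement_pmf B b sel i (depart k i X)) f - f X))"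

lemma statesD:
  assumes "X \<in> states"
  shows "k \<notin> configs B b \<Longrightarrow> X k = 0"
    and "(\<Sum>k\<in>configs B b. real (k i) * real (X k)) = \<rho> i * r"
  using assms by (auto simp: closed_states_def)

text \<open>Every counted server holds at least one customer, and the system holds \<open>r\<close>
  customers in all because the \<open>\<rho> i\<close> sum to 1.\<close>

lemma sum_states_le:
  assumes "X \<in> states" shows "(\<Sum>k\<in>configs B b. real (X k)) \<le> r"
proof -
  have "(\<Sum>k\<in>configs B b. real (X k)) \<le> (\<Sum>k\<in>configs B b. (\<Sum>i\<in>UNIV. real (k i)) * real (X k))"
  proof (rule sum_mono)
    fix k assume "k \<in> configs B b"
    then have "k \<noteq> empty_config" by auto
    then obtain i where "k i > 0" by (rule neq_empty_configE)
    then have "1 \<le> real (k i)" by simp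
    also have "\<dots> \<le> (\<Sum>i\<in>UNIV. real (k i))" by (intro member_le_sum) auto
    finally have "1 * real (X k) \<le> (\<Sum>i\<in>UNIV. real (k i)) * real (X k)"
      by (rule mult_right_mono) simp
    then show "real (X k) \<le> (\<Sum>i\<in>UNIV. real (k i)) * real (X k)" by simp
  qed
  also have "\<dots> = (\<Sum>i\<in>UNIV. \<Sum>k\<in>configs B b. real (k i) * real (X k))"
    by (subst sum.swap) (simp add: sum_distrib_right)
  also have "\<dots> = r"
    by (simp add: statesD[OF assms] sum_distrib_right[symmetric] sum_rho)
  finally show ?thesis .
qed

lemma agg_states_le:
  assumes "X \<in> states" "q \<in> aconfs B b" shows "real (agg X q) \<le> r"
proof -
  have "real (agg X q) \<le> (\<Sum>k\<in>configs B b. real (X k))"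
    unfolding agg_def of_nat_sum using aconfs_subset[OF assms(2)] by (intro sum_mono2) auto
  then show ?thesis using sum_states_le[OF assms(1)] by simp
qed

lemma states_le:
  assumes "X \<in> states" shows "real (X k) \<le> r"
proof (cases "k \<in> configs B b")
  case True
  then have "real (X k) \<le> (\<Sum>k\<in>configs B b. real (X k))"
    by (intro member_le_sum) auto
  then show ?thesis using sum_states_le[OF assms] by simp
next
  case False
  then show ?thesis using statesD(1)[OF assms] r_ge_1 by simp
qed

lemma finite_states: "finite states"
proof (rule finite_subset)
  show "states \<subseteq> {X. \<forall>k. (k \<in> configs B b \<longrightarrow> X k \<in> {..nat \<lfloor>r\<rfloor>}) \<and> (k \<notin> configs B b \<longrightarrow> X k = 0)}"
    using states_le statesD(1) by (auto simp: le_nat_floor)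
  show "finite {X. \<forall>k. (k \<in> configs B b \<longrightarrow> X k \<in> {..nat \<lfloor>r\<rfloor>}) \<and> (k \<notin> configs B b \<longrightarrow> X k = 0)}"
    by (rule finite_set_of_finite_funs) auto
qed

lemma total_rate:
  assumes "X \<in> states"
  shows "(\<Sum>k\<in>configs B b. \<Sum>i\<in>UNIV. \<mu> i * real (k i) * real (X k)) = \<Lambda> * r"
proof -
  have "(\<Sum>k\<in>configs B b. \<Sum>i\<in>UNIV. \<mu> i * real (k i) * real (X k))
      = (\<Sum>i\<in>UNIV. \<mu> i * (\<Sum>k\<in>configs B b. real (k i) * real (X k)))"
    by (subst sum.swap) (simp add: sum_distrib_left mult.assoc)
  then show ?thesis
    by (simp add: statesD[OF assms] \<Lambda>_def sum_distrib_right mult.assoc)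
qed

lemma sel_placeable: "placeable B b X i (sel i X)"
  and sel_minimal: "placeable B b X i q \<Longrightarrow> greedy_weight B b \<alpha> X i (sel i X) \<le> greedy_weight B b \<alpha> X i q"
  using greedy by (auto simp: greedy_rule_def is_arg_min_def not_less)

lemma set_sel_server_pmf:
  assumes "k \<in> set_pmf (server_pmf B b X (sel i X))"
  shows "sel i X = cls k" "k \<in> configs0 B b" "add_cust i k \<in> configs0 B b"
    "k = empty_config \<or> X k > 0"
proof -
  have q: "sel i X \<in> aconfs0 B b" "can_add B b i (sel i X)"
    using sel_placeable[of X i] by (auto simp: placeable_def)
  note k = set_server_pmf[OF sel_placeable assms]
  show "sel i X = cls k" using q(1) k(1) by (rule aconfs0_cls)
  show "k \<in> configs0 B b" using aconfs0_subset[OF q(1)] k(1) by blast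
  show "add_cust i k \<in> configs0 B b" using q(2) k(1) by (simp add: can_add_def)
  show "k = empty_config \<or> X k > 0" by (rule k(2))
qed

lemma finite_server_pmf: "finite (set_pmf (server_pmf B b X (sel i X)))"
  using set_sel_server_pmf(2) finite_configs0 by (blast intro: finite_subset)

lemma depart_avail:
  "k i > 0 \<Longrightarrow> del_cust i k = empty_config \<or> depart k i X (del_cust i k) > 0"
  using change_server_avail[of k "del_cust i k"] del_cust_neq[of k i] by metis

lemma placement_states:
  assumes "X \<in> states" "k \<in> configs B b" "k i > 0" "X k > 0"
    and "k' \<in> configs0 B b" "add_cust i k' \<in> configs0 B b"
    and "k' = empty_config \<or> depart k i X k' > 0"
  shows "change_server k' (add_cust i k') (depart k i X) \<in> states"
proof -
  have del: "del_cust i k \<in> configs0 B b"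
    using assms del_cust_in_configs0 configs_configs0 by blast
  let ?Z = "change_server k' (add_cust i k') (depart k i X)"
  have "?Z j = 0" if "j \<notin> configs B b" for j
  proof (cases "j = empty_config")
    case True
    then show ?thesis using statesD(1)[OF assms(1)] by simp
  next
    case False
    then have "j \<notin> configs0 B b" using that by (simp add: configs_def)
    then have "real (?Z j) = real (X j)"
      using assms del False by (auto simp: change_server_apply configs_configs0)
    then show ?thesis using statesD(1)[OF assms(1) that] by simp
  qed
  moreover have "(\<Sum>j\<in>configs B b. real (j l) * real (?Z j)) = \<rho> l * r" for l
  proof -
    \<comment> \<open>The empty configuration holds no customers, so whether it is counted does not
      matter here.\<close>
    have z: "(if j \<in> configs B b then real (j l) else 0) = real (j l)" if "j \<in> configs0 B b" for j
      using that by (auto simp: configs_def empty_config_def)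
    have "real (k l) = real (del_cust i k l) + of_bool (l = i)"
      "real (add_cust i k' l) = real (k' l) + of_bool (l = i)"
      using assms(3) by (auto simp: del_cust_def add_cust_def of_nat_diff)
    then show ?thesis
      using assms del
      by (simp add: sum_change_server z configs_configs0 statesD[OF assms(1)])
  qed
  ultimately show ?thesis by (simp add: closed_states_def)
qed

lemma set_placement_pmf:
  assumes "X \<in> states" "k \<in> configs B b" "k i > 0" "X k > 0"
  shows "set_pmf (placement_pmf B b sel i (depart k i X)) \<subseteq> states"
proof
  fix Y assume "Y \<in> set_pmf (placement_pmf B b sel i (depart k i X))"
  then obtain k' where k': "k' \<in> set_pmf (server_pmf B b (depart k i X) (sel i (depart k i X)))"
    and "Y = change_server k' (add_cust i k') (depart k i X)"
    by (auto simp: placement_pmf_def)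
  then show "Y \<in> states"
    using placement_states[OF assms] set_sel_server_pmf[OF k'] by simp
qed

lemma drift_eq:
  assumes "X \<in> states"
  shows "(\<Sum>Y\<in>states. closed_rate B b \<mu> sel X Y * (f Y - f X)) = drift f X"
proof -
  let ?p = "\<lambda>k i. placement_pmf B b sel i (depart k i X)"
  have "(\<Sum>Y\<in>states. closed_rate B b \<mu> sel X Y * (f Y - f X))
     = (\<Sum>Y\<in>states. \<Sum>k\<in>configs B b. \<Sum>i\<in>UNIV. \<mu> i * real (k i) * real (X k) *
        (pmf (?p k i) Y * (f Y - f X)))"
    by (simp add: closed_rate_def sum_distrib_right mult.assoc)
  also have "\<dots> = (\<Sum>k\<in>configs B b. \<Sum>i\<in>UNIV. \<mu> i * real (k i) * real (X k) *
        (\<Sum>Y\<in>states. pmf (?p k i) Y * (f Y - f X)))"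
    by (simp add: sum.swap[where A = states] sum_distrib_left)
  also have "\<dots> = drift f X"
    unfolding drift_def
  proof (intro sum.cong refl)
    fix k i assume k: "k \<in> configs B b"
    show "\<mu> i * real (k i) * real (X k) * (\<Sum>Y\<in>states. pmf (?p k i) Y * (f Y - f X))
        = \<mu> i * real (k i) * real (X k) * (measure_pmf.expectation (?p k i) f - f X)"
    \<comment> \<open>In the other case the placement may lead outside \<open>states\<close>, but
      the rate is 0.\<close>
    proof (cases "k i > 0 \<and> X k > 0")
      case True
      then have sub: "set_pmf (?p k i) \<subseteq> states"
        using set_placement_pmf assms k by blast
      have "measure_pmf.expectation (?p k i) f = (\<Sum>Y\<in>states. f Y * pmf (?p k i) Y)"
        using sub by (intro integral_measure_pmf_real finite_states) auto
      moreover have "(\<Sum>Y\<in>states. pmf (?p k i) Y) = 1"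
        using sub finite_states by (rule sum_pmf_eq_1[rotated])
      ultimately show ?thesis
        by (simp add: right_diff_distrib sum_subtractf sum_distrib_right[symmetric] mult.commute[of "f _"])
    qed auto
  qed
  finally show ?thesis .
qed

text \<open>The drift of any \<open>f\<close> has stationary mean 0, so a bound in every state turns
  into a bound on the stationary mean. Both moment estimates below are instances.\<close>

lemma stationary_le:
  fixes A f :: "'i state \<Rightarrow> real"
  assumes "stationary_dist states (closed_rate B b \<mu> sel) \<pi>"
    and "\<And>X. X \<in> states \<Longrightarrow> A X \<le> drift f X + c"
  shows "measure_pmf.expectation \<pi> A \<le> c"
proof -
  have sub: "set_pmf \<pi> \<subseteq> states" using assms(1) by (simp add: stationary_dist_def)
  then have fin: "finite (set_pmf \<pi>)" using finite_states finite_subset by blast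
  have "measure_pmf.expectation \<pi> A \<le> measure_pmf.expectation \<pi>
      (\<lambda>X. (\<Sum>Y\<in>states. closed_rate B b \<mu> sel X Y * (f Y - f X)) + c)"
    using sub assms(2) fin
    by (intro integral_mono_AE) (auto simp: AE_measure_pmf_iff drift_eq intro: integrable_measure_pmf_finite)
  also have "\<dots> = c"
    using fin stationary_dist_drift[OF finite_states assms(1), of f]
    by (subst Bochner_Integration.integral_add) (auto intro: integrable_measure_pmf_finite)
  finally show ?thesis .
qed

lemma drift_ge:
  assumes "\<And>k i. k \<in> configs B b \<Longrightarrow> k i > 0 \<Longrightarrow> X k > 0 \<Longrightarrow>
     a k i \<le> measure_pmf.expectation (placement_pmf B b sel i (depart k i X)) f - f X"
  shows "(\<Sum>k\<in>configs B b. \<Sum>i\<in>UNIV. \<mu> i * real (k i) * real (X k) * a k i) \<le> drift f X"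
  unfolding drift_def
proof (intro sum_mono)
  fix k i assume k: "k \<in> configs B b"
  show "\<mu> i * real (k i) * real (X k) * a k i \<le> \<mu> i * real (k i) * real (X k) *
     (measure_pmf.expectation (placement_pmf B b sel i (depart k i X)) f - f X)"
  proof (cases "k i > 0 \<and> X k > 0")
    case True
    then show ?thesis using assms[OF k, of i] mu_pos[of i] by (intro mult_left_mono) auto
  qed auto
qed

end

section \<open>The two drift estimates\<close>

context greedy_system
begin

text \<open>The partial sums make a single placement change \<open>potential\<close> exactly by the greedy
  weight, up to replacing \<open>agg X q\<close> by \<open>agg X q - 1\<close>.\<close>

definition potential :: "'i state \<Rightarrow> real" where
  "potential X = (\<Sum>q\<in>aconfs B b. \<Sum>j<agg X q. real j powr \<alpha>)"

lemma potential_placement: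
  assumes "k \<in> configs0 B b" "add_cust i k \<in> configs0 B b" "k = empty_config \<or> X k > 0"
  shows "potential (change_server k (add_cust i k) X) - potential X
       = greedy_weight B b \<alpha> X i (cls k)
         + (if k \<noteq> empty_config then real (agg X (cls k)) powr \<alpha> - (real (agg X (cls k)) - 1) powr \<alpha> else 0)"
proof -
  let ?Y = "change_server k (add_cust i k) X" and ?G = "\<lambda>n. \<Sum>j<n. real j powr \<alpha>"
  let ?p = "cls k" and ?p' = "cls (add_cust i k)"
  have ne: "?p' \<noteq> ?p" using cls_add_cust_neq[OF assms(1)] .
  have p': "?p' \<in> aconfs B b" using assms(2) add_cust_configs cls_in_aconfs by blast
  have G: "?G (agg ?Y q) - ?G (agg X q)
      = (if q = ?p' then real (agg X ?p') powr \<alpha> else 0)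
        - (if q = ?p then (real (agg X ?p) - 1) powr \<alpha> else 0)" if q: "q \<in> aconfs B b" for q
  proof -
    have q0: "q \<in> aconfs0 B b" using q by (simp add: aconfs_iff)
    have "real (agg ?Y q) = real (agg X q) - of_bool (q = ?p) + of_bool (q = ?p')"
      using agg_change_server[where k = k and X = X, OF q assms(3)] cls_eq_iff[OF q0] assms by simp
    moreover have "agg X q = Suc (agg X q - 1)" if "q = ?p"
    proof -
      have "k \<noteq> empty_config"
        using that q cls_empty by (auto simp: aconfs_iff)
      then have "X k > 0" using assms(3) by simp
      have "X k \<le> agg X q"
        unfolding agg_def using that cls_self[OF assms(1)] finite_aconf[OF q0]
        by (intro member_le_sum) auto
      then show ?thesis using \<open>X k > 0\<close> by simp
    qed
    moreover have "?G n - ?G (Suc n) = - (real n powr \<alpha>)" for n by simp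
    ultimately consider "q = ?p'" "agg ?Y q = Suc (agg X q)"
      | "q = ?p" "agg X q = Suc (agg ?Y q)" | "q \<noteq> ?p" "q \<noteq> ?p'" "agg ?Y q = agg X q"
      using ne by (cases "q = ?p"; cases "q = ?p'") force+
    then show ?thesis
      using ne by cases auto
  qed
  have "potential ?Y - potential X = (\<Sum>q\<in>aconfs B b. ?G (agg ?Y q) - ?G (agg X q))"
    by (simp add: potential_def sum_subtractf)
  also have "\<dots> = real (agg X ?p') powr \<alpha>
      - (if ?p \<in> aconfs B b then (real (agg X ?p) - 1) powr \<alpha> else 0)"
    using p' by (simp add: G sum_subtractf)
  \<comment> \<open>The potential leaves out the empty class, in accordance with the case
    distinction in \<open>greedy_weight\<close>.\<close>
  also have "?p \<in> aconfs B b \<longleftrightarrow> k \<noteq> empty_config"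
    using assms(1) cls_empty cls_in_aconfs[of k] by (auto simp: aconfs_iff configs_def)
  also have "real (agg X ?p') powr \<alpha> - (if k \<noteq> empty_config then (real (agg X ?p) - 1) powr \<alpha> else 0)
      = greedy_weight B b \<alpha> X i ?p
         + (if k \<noteq> empty_config then real (agg X ?p) powr \<alpha> - (real (agg X ?p) - 1) powr \<alpha> else 0)"
    using add_aconf_cls[OF assms(1,2)] cls_empty cls_self[OF assms(1)]
    by (auto simp: greedy_weight_def empty_aconf_eq)
  finally show ?thesis .
qed

text \<open>The regret of returning the customer to the server it left, relative to the selected
  placement. Both weights are taken in the state after the departure, in which the rule
  decides.\<close>

definition loss :: "'i config \<Rightarrow> 'i \<Rightarrow> 'i state \<Rightarrow> real" where
  "loss k i X = (let X' = depart k i X in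
     greedy_weight B b \<alpha> X' i (cls (del_cust i k)) - greedy_weight B b \<alpha> X' i (sel i X'))"

lemma placeable_depart:
  assumes "k \<in> configs B b" "k i > 0"
  shows "placeable B b (depart k i X) i (cls (del_cust i k))"
  using assms add_del_cust[where k = k and i = i] del_cust_in_configs0[of k i]
    depart_avail[where k = k and i = i and X = X]
  by (intro placeable_cls) (auto simp: configs_configs0)

lemma loss_nonneg: "k \<in> configs B b \<Longrightarrow> k i > 0 \<Longrightarrow> loss k i X \<ge> 0"
  using sel_minimal[OF placeable_depart] by (simp add: loss_def Let_def)

text \<open>A departure raises an aggregate count by at most one, and
  \<open>r + 1 \<le> 2 * r\<close>.\<close>

lemma depart_agg_le:
  assumes "X \<in> states" "X k > 0" "q \<in> aconfs B b"
  shows "real (agg (depart k i X) q) \<le> 2 * r"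
  using agg_change_server[OF assms(3), of k X "del_cust i k"] agg_states_le[OF assms(1,3)] assms(2) r_ge_1
  by (auto simp: of_bool_def split: if_splits)

text \<open>Undoing the departure is itself a placement, leading from the intermediate state back to
  \<open>X\<close>; hence \<open>potential_placement\<close> describes both halves of the move. The
  correction in the undone half has the favourable sign, so only the actual placement costs
  \<open>e\<close>.\<close>

lemma potential_move:
  assumes "X \<in> states" "k \<in> configs B b" "k i > 0" "X k > 0"
    and e: "\<And>n::nat. 1 \<le> n \<Longrightarrow> real n \<le> 2 * r \<Longrightarrow> real n powr \<alpha> - (real n - 1) powr \<alpha> \<le> e" "e \<ge> 0"
    and Y: "Y \<in> set_pmf (placement_pmf B b sel i (depart k i X))"
  shows "potential Y - potential X \<le> e - loss k i X"
proof -
  let ?X = "depart k i X" and ?d = "del_cust i k"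
  obtain k' where k': "k' \<in> set_pmf (server_pmf B b ?X (sel i ?X))"
    and Y': "Y = change_server k' (add_cust i k') ?X"
    using Y by (auto simp: placement_pmf_def)
  note k'_props = set_sel_server_pmf[OF k']
  have d: "?d \<in> configs0 B b" "add_cust i ?d = k"
    using assms del_cust_in_configs0[of k i] add_del_cust[where k = k and i = i]
    by (auto simp: configs_configs0)
  have undo: "change_server ?d k ?X = X"
    using assms(3,4) del_cust_neq[where k = k and i = i] by (intro change_server_back) auto
  have "potential X - potential ?X = greedy_weight B b \<alpha> ?X i (cls ?d) + (if ?d \<noteq> empty_config
      then real (agg ?X (cls ?d)) powr \<alpha> - (real (agg ?X (cls ?d)) - 1) powr \<alpha> else 0)"
    using potential_placement[of ?d i ?X] d assms(2,3) undo
      depart_avail[where k = k and i = i and X = X] by (simp add: configs_configs0)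
  moreover have "real (agg ?X (cls ?d)) powr \<alpha> - (real (agg ?X (cls ?d)) - 1) powr \<alpha> \<ge> 0"
    if "?d \<noteq> empty_config"
  proof -
    have "agg ?X (cls ?d) > 0"
      using placeable_depart[OF assms(2,3), of X] that d(1) cls_self[OF d(1)] cls_empty
      by (auto simp: placeable_def empty_aconf_eq)
    then show ?thesis using alpha_pos by (simp add: powr_mono2)
  qed
  ultimately have 1: "greedy_weight B b \<alpha> ?X i (cls ?d) \<le> potential X - potential ?X"
    by auto
  have "real (agg ?X (cls k')) powr \<alpha> - (real (agg ?X (cls k')) - 1) powr \<alpha> \<le> e"
    if ne: "k' \<noteq> empty_config"
  proof (rule e)
    have "cls k' \<noteq> empty_aconf B b"
      using ne cls_self[OF k'_props(2)] cls_empty by (auto simp: empty_aconf_eq)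
    then show "1 \<le> agg ?X (cls k')"
      using sel_placeable[of ?X i] k'_props(1) by (auto simp: placeable_def)
    show "real (agg ?X (cls k')) \<le> 2 * r"
      using assms ne k'_props(2) by (intro depart_agg_le cls_in_aconfs) (auto simp: configs_def)
  qed
  then have "potential Y - potential ?X \<le> greedy_weight B b \<alpha> ?X i (sel i ?X) + e"
    using potential_placement[where k = k' and X = ?X, OF k'_props(2-4)] k'_props(1) Y' e(2) by auto
  then show ?thesis using 1 by (simp add: loss_def Let_def)
qed

definition total_loss :: "'i state \<Rightarrow> real" where
  "total_loss X = (\<Sum>k\<in>configs B b. \<Sum>i\<in>UNIV. \<mu> i * real (k i) * real (X k) * loss k i X)"

lemma total_loss_nonneg: "total_loss X \<ge> 0"
  unfolding total_loss_def
proof (intro sum_nonneg)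
  fix k i assume "k \<in> configs B b"
  then show "0 \<le> \<mu> i * real (k i) * real (X k) * loss k i X"
    using loss_nonneg[of k i X] mu_pos[of i] by (cases "k i > 0") auto
qed

lemma finite_placement_pmf: "finite (set_pmf (placement_pmf B b sel i X))"
  by (simp add: placement_pmf_def finite_server_pmf)

text \<open>Moves occur at total rate \<open>\<Lambda> * r\<close>, and each raises the potential by
  at most \<open>e\<close> minus its loss; in stationarity the two contributions must
  balance.\<close>

lemma expected_loss_le:
  assumes "stationary_dist states (closed_rate B b \<mu> sel) \<pi>"
    and e: "\<And>n::nat. 1 \<le> n \<Longrightarrow> real n \<le> 2 * r \<Longrightarrow> real n powr \<alpha> - (real n - 1) powr \<alpha> \<le> e" "e \<ge> 0"
  shows "measure_pmf.expectation \<pi> total_loss \<le> e * (\<Lambda> * r)"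
proof (rule stationary_le[OF assms(1)])
  fix X assume X: "X \<in> states"
  have "(\<Sum>k\<in>configs B b. \<Sum>i\<in>UNIV. \<mu> i * real (k i) * real (X k) * (loss k i X - e))
      \<le> drift (\<lambda>X. - potential X) X"
  proof (rule drift_ge)
    fix k i assume k: "k \<in> configs B b" "k i > 0" "X k > 0"
    have "loss k i X - e - potential X
        \<le> measure_pmf.expectation (placement_pmf B b sel i (depart k i X)) (\<lambda>X. - potential X)"
      using potential_move[OF X k e] by (intro expectation_ge_const finite_placement_pmf) force
    then show "loss k i X - e \<le> measure_pmf.expectation (placement_pmf B b sel i (depart k i X))
        (\<lambda>X. - potential X) - - potential X"
      by linarith
  qed
  moreover have "(\<Sum>k\<in>configs B b. \<Sum>i\<in>UNIV. \<mu> i * real (k i) * real (X k) * (loss k i X - e))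
      = total_loss X - e * (\<Lambda> * r)"
    unfolding total_loss_def total_rate[OF X, symmetric]
    by (simp add: right_diff_distrib sum_subtractf sum_distrib_left mult_ac)
  ultimately show "total_loss X \<le> drift (\<lambda>X. - potential X) X + e * (\<Lambda> * r)"
    by simp
qed

end

text \<open>Since servers are chosen uniformly within an aggregate configuration, placements deplete a
  configuration \<open>\<kappa>\<close> at a rate at most proportional to \<open>X \<kappa> / agg X (cls \<kappa>)\<close>, while departures from
  \<open>add_cust i \<kappa>\<close> replenish it. This test function weighs the balance so that the resulting
  moment bound forbids \<open>X \<kappa>\<close> to be negligible when both \<open>agg X (cls \<kappa>)\<close> and
  \<open>X (add_cust i \<kappa>)\<close> are not.\<close>

definition (in packing) spread_fn :: "'i config \<Rightarrow> 'i state \<Rightarrow> real" where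
  "spread_fn \<kappa> X = real (agg X (cls \<kappa>)) * sqrt (real (X \<kappa>) + 1)"

section \<open>Changes of the spread function under departures and placements\<close>

lemma sqrt_Suc_diff_ge:
  fixes y :: real assumes "y \<ge> 0"
  shows "sqrt (y + 2) - sqrt (y + 1) \<ge> 1 / (2 * sqrt (y + 2))"
proof -
  have "(sqrt (y + 2) - sqrt (y + 1)) * (sqrt (y + 2) + sqrt (y + 1)) = 1"
    using assms by (simp add: algebra_simps)
  moreover have "(sqrt (y + 2) - sqrt (y + 1)) * (sqrt (y + 2) + sqrt (y + 1))
      \<le> (sqrt (y + 2) - sqrt (y + 1)) * (2 * sqrt (y + 2))"
    by (intro mult_left_mono) auto
  ultimately show ?thesis using assms by (simp add: divide_le_eq)
qed

lemma sqrt_Suc_diff_le: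
  fixes y :: real assumes "y \<ge> 0"
  shows "sqrt (y + 1) - sqrt y \<le> 1 / sqrt (y + 1)"
proof -
  have "(sqrt (y + 1) - sqrt y) * sqrt (y + 1) \<le> (sqrt (y + 1) - sqrt y) * (sqrt (y + 1) + sqrt y)"
    using assms by (intro mult_left_mono) auto
  also have "\<dots> = 1" using assms by (simp add: algebra_simps)
  finally show ?thesis using assms by (simp add: le_divide_eq)
qed

context greedy_system
begin

text \<open>Separates the two factors: the aggregate count falls by at most one, at the price of one
  square root, and the change of the square root is weighted by the old aggregate count.\<close>

lemma spread_fn_change:
  fixes X :: "'i state" and l :: "'i config"
  assumes "\<kappa> \<in> configs B b" "k = empty_config \<or> X k > 0"
  defines "Y \<equiv> change_server k l X"
  shows "spread_fn \<kappa> Y - spread_fn \<kappa> X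
      \<ge> real (agg X (cls \<kappa>)) * (sqrt (real (Y \<kappa>) + 1) - sqrt (real (X \<kappa>) + 1)) - sqrt (real (X \<kappa>) + 2)"
proof -
  have "real (agg Y (cls \<kappa>)) \<ge> real (agg X (cls \<kappa>)) - 1"
    unfolding Y_def agg_change_server[where k = k and X = X, OF cls_in_aconfs[OF assms(1)] assms(2)] by simp
  then have "real (agg Y (cls \<kappa>)) * sqrt (real (Y \<kappa>) + 1) \<ge> (real (agg X (cls \<kappa>)) - 1) * sqrt (real (Y \<kappa>) + 1)"
    by (intro mult_right_mono) auto
  moreover have "sqrt (real (Y \<kappa>) + 1) \<le> sqrt (real (X \<kappa>) + 2)"
    using change_server_apply[where k = k and X = X and k' = l, OF assms(2) configs_neq_empty[OF assms(1)]] by (simp add: Y_def)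
  moreover have "(real (agg X (cls \<kappa>)) - 1) * sqrt (real (Y \<kappa>) + 1)
      = real (agg X (cls \<kappa>)) * sqrt (real (Y \<kappa>) + 1) - sqrt (real (Y \<kappa>) + 1)"
    by (simp add: left_diff_distrib)
  ultimately show ?thesis unfolding spread_fn_def right_diff_distrib by linarith
qed

lemma sqrt_le_2_sqrt_r: "y + 2 \<le> 4 * r \<Longrightarrow> sqrt (y + 2) \<le> 2 * sqrt r"
  using real_sqrt_le_mono[of "y + 2" "4 * r"] by (simp add: real_sqrt_mult)

text \<open>Picking \<open>\<kappa>\<close> may cost as much as
  \<open>agg X (cls \<kappa>) / sqrt (X \<kappa> + 1)\<close>, but its probability is at most
  \<open>X \<kappa> / agg X (cls \<kappa>)\<close>, so the expected cost is below
  \<open>sqrt (X \<kappa> + 1)\<close>. One \<open>2 * sqrt r\<close> pays for this, the other for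
  the change of the aggregate count.\<close>

lemma spread_fn_placement:
  assumes \<kappa>: "\<kappa> \<in> configs B b" and le: "real (X \<kappa>) + 2 \<le> 4 * r"
  shows "measure_pmf.expectation (placement_pmf B b sel i X) (spread_fn \<kappa>) \<ge> spread_fn \<kappa> X - 4 * sqrt r"
proof -
  let ?p = "server_pmf B b X (sel i X)" and ?Z = "real (agg X (cls \<kappa>))" and ?s = "sqrt (real (X \<kappa>) + 1)"
  have int: "integrable ?p f" for f :: "'i config \<Rightarrow> real"
    by (rule integrable_measure_pmf_finite[OF finite_server_pmf])
  have "spread_fn \<kappa> X - sqrt (real (X \<kappa>) + 2) - (?Z / ?s) * indicator {\<kappa>} k
      \<le> spread_fn \<kappa> (change_server k (add_cust i k) X)" if k: "k \<in> set_pmf ?p" for k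
  proof -
    note kp = set_sel_server_pmf[OF k]
    let ?Y = "change_server k (add_cust i k) X"
    have Y: "real (?Y \<kappa>) = real (X \<kappa>) - of_bool (\<kappa> = k) + of_bool (\<kappa> = add_cust i k)"
      using change_server_apply[where k = k and X = X, OF kp(4) configs_neq_empty[OF \<kappa>]] .
    have "?Z * (sqrt (real (?Y \<kappa>) + 1) - ?s) \<ge> - ((?Z / ?s) * indicator {\<kappa>} k)"
    proof (cases "k = \<kappa>")
      case True
      then have ne: "\<kappa> \<noteq> add_cust i k" and "X \<kappa> > 0"
        using kp(4) configs_neq_empty[OF \<kappa>] cls_add_cust_neq[OF kp(2), of i] by auto
      then have "?Z * (?s - sqrt (real (X \<kappa>))) \<le> ?Z * (1 / ?s)"
        by (intro mult_left_mono sqrt_Suc_diff_le) auto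
      then show ?thesis using Y True ne by (simp add: algebra_simps)
    next
      case False
      then show ?thesis using Y by (auto intro!: mult_nonneg_nonneg)
    qed
    then show ?thesis
      using spread_fn_change[where k = k and X = X and l = "add_cust i k", OF \<kappa> kp(4)] by linarith
  qed
  then have "measure_pmf.expectation ?p (\<lambda>k. spread_fn \<kappa> X - sqrt (real (X \<kappa>) + 2) - (?Z / ?s) * indicator {\<kappa>} k)
      \<le> measure_pmf.expectation ?p (\<lambda>k. spread_fn \<kappa> (change_server k (add_cust i k) X))"
    by (intro integral_mono_AE int) (simp add: AE_measure_pmf_iff)
  also have "\<dots> = measure_pmf.expectation (placement_pmf B b sel i X) (spread_fn \<kappa>)"
    by (simp add: placement_pmf_def)
  also have "measure_pmf.expectation ?p (\<lambda>k. spread_fn \<kappa> X - sqrt (real (X \<kappa>) + 2) - (?Z / ?s) * indicator {\<kappa>} k)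
      = spread_fn \<kappa> X - sqrt (real (X \<kappa>) + 2) - (?Z / ?s) * pmf ?p \<kappa>"
    by (subst Bochner_Integration.integral_diff[OF int int]) (simp add: pmf.rep_eq)
  finally have "spread_fn \<kappa> X - sqrt (real (X \<kappa>) + 2) - (?Z / ?s) * pmf ?p \<kappa>
      \<le> measure_pmf.expectation (placement_pmf B b sel i X) (spread_fn \<kappa>)" .
  moreover have "(?Z / ?s) * pmf ?p \<kappa> \<le> ?s"
  proof -
    have "(?Z / ?s) * pmf ?p \<kappa> = (pmf ?p \<kappa> * ?Z) / ?s" by simp
    also have "\<dots> \<le> real (X \<kappa>) / ?s"
      using pmf_server_pmf_le[OF sel_placeable configs_neq_empty configs_configs0] \<kappa>
      by (intro divide_right_mono) auto
    also have "\<dots> \<le> ?s" by (simp add: divide_le_eq)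
    finally show ?thesis .
  qed
  moreover have "sqrt (real (X \<kappa>) + 2) \<le> 2 * sqrt r" by (rule sqrt_le_2_sqrt_r[OF le])
  moreover have "?s \<le> sqrt (real (X \<kappa>) + 2)" by simp
  ultimately show ?thesis by linarith
qed

text \<open>Only departures of type \<open>j\<close> from \<open>add_cust j \<kappa>\<close> are
  credited; any other departure ending in \<open>\<kappa>\<close> raises the square root too, and
  this gain is dropped.\<close>

lemma spread_fn_depart:
  assumes \<kappa>: "\<kappa> \<in> configs B b" and k: "k \<in> configs B b" "k i > 0" "X k > 0"
    and le: "real (X \<kappa>) + 2 \<le> 4 * r"
  shows "spread_fn \<kappa> (depart k i X) - spread_fn \<kappa> X \<ge> real (agg X (cls \<kappa>)) *
     ((if k = add_cust j \<kappa> \<and> i = j then 1 / (2 * sqrt (real (X \<kappa>) + 2)) else 0)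
       - (if k = \<kappa> then 1 / sqrt (real (X \<kappa>) + 1) else 0)) - 2 * sqrt r"
proof -
  let ?Y = "depart k i X" and ?y = "real (X \<kappa>)"
  have Y: "real (?Y \<kappa>) = ?y - of_bool (\<kappa> = k) + of_bool (\<kappa> = del_cust i k)"
    using change_server_apply[where k = k and X = X, OF _ configs_neq_empty[OF \<kappa>]] k by blast
  have "sqrt (real (?Y \<kappa>) + 1) - sqrt (?y + 1) \<ge>
      (if k = add_cust j \<kappa> \<and> i = j then 1 / (2 * sqrt (?y + 2)) else 0)
       - (if k = \<kappa> then 1 / sqrt (?y + 1) else 0)"
  proof (cases "k = \<kappa>")
    case True
    then have "\<kappa> \<noteq> del_cust i k" "k \<noteq> add_cust j \<kappa>"
      using del_cust_neq[where k = k and i = i] k cls_add_cust_neq[OF configs_configs0[OF \<kappa>], of j] by auto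
    then show ?thesis using Y True sqrt_Suc_diff_le[of ?y] by simp
  next
    case False
    show ?thesis
    proof (cases "k = add_cust j \<kappa> \<and> i = j")
      case True
      then have "del_cust i k = \<kappa>" by (auto simp: del_cust_def add_cust_def)
      then show ?thesis using Y True False sqrt_Suc_diff_ge[of ?y] by (simp add: add.commute)
    next
      case no: False
      then show ?thesis using Y False by auto
    qed
  qed
  then have "real (agg X (cls \<kappa>)) * (sqrt (real (?Y \<kappa>) + 1) - sqrt (?y + 1)) \<ge> real (agg X (cls \<kappa>)) *
      ((if k = add_cust j \<kappa> \<and> i = j then 1 / (2 * sqrt (?y + 2)) else 0)
       - (if k = \<kappa> then 1 / sqrt (?y + 1) else 0))"
    by (rule mult_left_mono) simp
  then show ?thesis
    using spread_fn_change[where k = k and X = X and l = "del_cust i k", OF \<kappa>] k(3) sqrt_le_2_sqrt_r[OF le] by linarith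
qed

text \<open>The 6 adds the \<open>4 * sqrt r\<close> of a placement and the
  \<open>2 * sqrt r\<close> of a departure, paid at rate \<open>\<Lambda> * r\<close>. The inner sum
  stems from departures out of \<open>\<kappa>\<close>. The factor \<open>2 / \<mu> j\<close> undoes
  the rate of the credited departures and the half from \<open>sqrt_Suc_diff_ge\<close>.\<close>

lemma expected_spread_le:
  assumes "stationary_dist states (closed_rate B b \<mu> sel) \<pi>"
    and \<kappa>: "\<kappa> \<in> configs B b" and add: "add_cust j \<kappa> \<in> configs0 B b"
  shows "measure_pmf.expectation \<pi> (\<lambda>X. real (X (add_cust j \<kappa>)) * real (agg X (cls \<kappa>)) / sqrt (real (X \<kappa>) + 2))
     \<le> 2 / \<mu> j * (6 * \<Lambda> + 2 * (\<Sum>i\<in>UNIV. \<mu> i * real (\<kappa> i))) * (r * sqrt r)"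
    (is "_ \<le> 2 / \<mu> j * ?C * _")
proof -
  let ?k = "add_cust j \<kappa>"
  let ?f = "\<lambda>X. real (X ?k) * real (agg X (cls \<kappa>)) / sqrt (real (X \<kappa>) + 2)"
  have "measure_pmf.expectation \<pi> (\<lambda>X. \<mu> j / 2 * ?f X) \<le> ?C * (r * sqrt r)"
  proof (rule stationary_le[OF assms(1), where f = "spread_fn \<kappa>"])
    fix X assume X: "X \<in> states"
    let ?Z = "real (agg X (cls \<kappa>))" and ?y = "real (X \<kappa>)"
    define u where "u = 1 / (2 * sqrt (?y + 2))"
    define v where "v = 1 / sqrt (?y + 1)"
    have y: "?y \<le> r" using states_le[OF X] .
    have "(\<Sum>k\<in>configs B b. \<Sum>i\<in>UNIV. \<mu> i * real (k i) * real (X k) *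
        (?Z * ((if k = ?k \<and> i = j then u else 0) - (if k = \<kappa> then v else 0)) - 6 * sqrt r))
        \<le> drift (spread_fn \<kappa>) X"
    proof (rule drift_ge)
      fix k i assume k: "k \<in> configs B b" "k i > 0" "X k > 0"
      have "real (depart k i X \<kappa>) \<le> ?y + 1"
        using change_server_apply[where k = k and X = X and k' = "del_cust i k", OF _ configs_neq_empty[OF \<kappa>]] k(3) by simp
      then have "real (depart k i X \<kappa>) + 2 \<le> 4 * r"
        using y r_ge_1 by linarith
      note 1 = spread_fn_placement[where X = "depart k i X" and i = i, OF \<kappa> this]
      have "?y + 2 \<le> 4 * r" using y r_ge_1 by linarith
      note 2 = spread_fn_depart[where X = X and k = k and i = i and j = j, OF \<kappa> k this, folded u_def v_def]
      from 1 2 show "?Z * ((if k = ?k \<and> i = j then u else 0) - (if k = \<kappa> then v else 0)) - 6 * sqrt r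
          \<le> measure_pmf.expectation (placement_pmf B b sel i (depart k i X)) (spread_fn \<kappa>) - spread_fn \<kappa> X"
        by linarith
    qed
    also have "(\<Sum>k\<in>configs B b. \<Sum>i\<in>UNIV. \<mu> i * real (k i) * real (X k) *
        (?Z * ((if k = ?k \<and> i = j then u else 0) - (if k = \<kappa> then v else 0)) - 6 * sqrt r))
      = (\<Sum>k\<in>configs B b. \<Sum>i\<in>UNIV.
            (if k = ?k then if i = j then \<mu> j * real (?k j) * real (X ?k) * ?Z * u else 0 else 0))
        - (\<Sum>k\<in>configs B b. \<Sum>i\<in>UNIV. (if k = \<kappa> then \<mu> i * real (\<kappa> i) * ?y * ?Z * v else 0))
        - 6 * sqrt r * (\<Sum>k\<in>configs B b. \<Sum>i\<in>UNIV. \<mu> i * real (k i) * real (X k))"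
      unfolding sum_subtractf[symmetric] sum_distrib_left
      by (intro sum.cong refl) (auto simp: algebra_simps)
    also have "(\<Sum>k\<in>configs B b. \<Sum>i\<in>UNIV.
            (if k = ?k then if i = j then \<mu> j * real (?k j) * real (X ?k) * ?Z * u else 0 else 0))
        = (\<Sum>k\<in>configs B b. if k = ?k then \<mu> j * real (?k j) * real (X ?k) * ?Z * u else 0)"
      by (intro sum.cong refl) auto
    also have "\<dots> = \<mu> j * real (?k j) * real (X ?k) * ?Z * u"
      using add add_cust_configs by simp
    also have "(\<Sum>k\<in>configs B b. \<Sum>i\<in>UNIV. (if k = \<kappa> then \<mu> i * real (\<kappa> i) * ?y * ?Z * v else 0))
        = (\<Sum>k\<in>configs B b. if k = \<kappa> then (\<Sum>i\<in>UNIV. \<mu> i * real (\<kappa> i) * ?y * ?Z * v) else 0)"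
      by (intro sum.cong refl) auto
    also have "\<dots> = (\<Sum>i\<in>UNIV. \<mu> i * real (\<kappa> i)) * (?Z * (?y * v))"
      using \<kappa> by (simp add: sum_distrib_left sum_distrib_right mult_ac)
    finally have *: "\<mu> j * real (?k j) * real (X ?k) * ?Z * u
        - (\<Sum>i\<in>UNIV. \<mu> i * real (\<kappa> i)) * (?Z * (?y * v)) - 6 * sqrt r * (\<Lambda> * r) \<le> drift (spread_fn \<kappa>) X"
      unfolding total_rate[OF X] .
    have "?y * v \<le> sqrt (?y + 1)" by (simp add: v_def divide_le_eq)
    also have "\<dots> \<le> sqrt (?y + 2)" by simp
    also have "\<dots> \<le> 2 * sqrt r" using y r_ge_1 by (intro sqrt_le_2_sqrt_r) simp
    finally have "?y * v \<le> 2 * sqrt r" .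
    then have "?Z * (?y * v) \<le> r * (2 * sqrt r)"
      by (rule mult_mono[OF agg_states_le[OF X cls_in_aconfs[OF \<kappa>]]])
        (use r_ge_1 in \<open>auto simp: v_def\<close>)
    then have **: "(\<Sum>i\<in>UNIV. \<mu> i * real (\<kappa> i)) * (?Z * (?y * v))
        \<le> (\<Sum>i\<in>UNIV. \<mu> i * real (\<kappa> i)) * (r * (2 * sqrt r))"
      using mu_pos by (intro mult_left_mono sum_nonneg) (auto simp: less_imp_le)
    have "\<mu> j / 2 * ?f X = \<mu> j * 1 * (real (X ?k) * ?Z * u)"
      by (simp add: u_def)
    also have "\<dots> \<le> \<mu> j * real (?k j) * (real (X ?k) * ?Z * u)"
      using mu_pos[of j] by (intro mult_right_mono mult_left_mono) (auto simp: add_cust_def u_def)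
    finally show "\<mu> j / 2 * ?f X \<le> drift (spread_fn \<kappa>) X + ?C * (r * sqrt r)"
      using * ** by (simp add: algebra_simps)
  qed
  then have "\<mu> j / 2 * measure_pmf.expectation \<pi> ?f \<le> ?C * (r * sqrt r)"
    by (simp only: integral_mult_right_zero)
  then show ?thesis
    using mu_pos[of j] by (simp add: field_simps)
qed

end

section \<open>Fluid limits\<close>

lemma convergent_subseq_finite:
  fixes f :: "nat \<Rightarrow> 'a \<Rightarrow> real"
  assumes "finite A" "\<And>n a. a \<in> A \<Longrightarrow> \<bar>f n a\<bar> \<le> C"
  shows "\<exists>s l. strict_mono (s :: nat \<Rightarrow> nat) \<and> (\<forall>a\<in>A. (\<lambda>n. f (s n) a) \<longlonglongrightarrow> l a)"
  using assms
proof (induction A rule: finite_induct)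
  case empty
  have "strict_mono (id :: nat \<Rightarrow> nat)" by (simp add: strict_mono_def)
  then show ?case by blast
next
  case (insert a A)
  have "\<exists>s l. strict_mono (s :: nat \<Rightarrow> nat) \<and> (\<forall>a\<in>A. (\<lambda>n. f (s n) a) \<longlonglongrightarrow> l a)"
    by (rule insert.IH) (simp add: insert.prems)
  then obtain s l where s: "strict_mono (s :: nat \<Rightarrow> nat)" "\<And>a. a \<in> A \<Longrightarrow> (\<lambda>n. f (s n) a) \<longlonglongrightarrow> l a"
    by blast
  have "bounded (range (\<lambda>n. f (s n) a))"
    using insert.prems by (auto simp: bounded_iff)
  then obtain c t where t: "strict_mono (t :: nat \<Rightarrow> nat)" "((\<lambda>n. f (s n) a) \<circ> t) \<longlonglongrightarrow> c"
    using bounded_imp_convergent_subsequence by blast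
  have "(\<lambda>n. f ((s \<circ> t) n) a') \<longlonglongrightarrow> (l(a := c)) a'" if "a' \<in> insert a A" for a'
    using t(2) LIMSEQ_subseq_LIMSEQ[OF s(2) t(1), of a'] that insert.hyps by (auto simp: o_def)
  then show ?case using strict_mono_o[OF s(1) t(1)] by blast
qed

text \<open>Divided by \<open>r powr \<alpha>\<close>, this is the increment of
  \<open>u powr \<alpha>\<close> over a step \<open>1 / r\<close> inside \<open>{0..2}\<close>.
  Uniform continuity treats all \<open>\<alpha> > 0\<close> alike, including
  \<open>\<alpha> < 1\<close>, where the derivative is unbounded near 0.\<close>

lemma powr_increment_small:
  fixes \<alpha> \<epsilon> :: real
  assumes "\<alpha> > 0" "\<epsilon> > 0"
  shows "eventually (\<lambda>r. \<forall>n::nat. 1 \<le> n \<longrightarrow> real n \<le> 2 * r \<longrightarrow>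
           real n powr \<alpha> - (real n - 1) powr \<alpha> \<le> \<epsilon> * r powr \<alpha>) at_top"
proof -
  have "continuous_on {0..2::real} (\<lambda>u. u powr \<alpha>)"
    using assms by (intro continuous_on_powr' continuous_intros) auto
  then have "uniformly_continuous_on {0..2::real} (\<lambda>u. u powr \<alpha>)"
    by (rule compact_uniformly_continuous) simp
  then obtain d where d: "d > 0"
    "\<And>u v. u \<in> {0..2} \<Longrightarrow> v \<in> {0..2} \<Longrightarrow> dist v u < d \<Longrightarrow> dist (v powr \<alpha>) (u powr \<alpha>) < \<epsilon>"
    using assms(2) unfolding uniformly_continuous_on_def by metis
  have "eventually (\<lambda>r. r > max 1 (1 / d)) at_top" by (rule eventually_gt_at_top)
  then show ?thesis
  proof eventually_elim
    case (elim r)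
    then have r: "r > 0" "1 / r < d" using d(1) by (auto simp: field_simps)
    show ?case
    proof (intro allI impI)
      fix n :: nat assume n: "1 \<le> n" "real n \<le> 2 * r"
      have "dist (real n / r) ((real n - 1) / r) = 1 / r"
        using r by (simp add: dist_real_def diff_divide_distrib)
      then have "dist ((real n / r) powr \<alpha>) (((real n - 1) / r) powr \<alpha>) < \<epsilon>"
        using r n by (intro d(2)) (auto simp: divide_le_eq)
      then have "(real n / r) powr \<alpha> - ((real n - 1) / r) powr \<alpha> < \<epsilon>"
        by (simp add: dist_real_def)
      moreover have "(real n / r) powr \<alpha> = real n powr \<alpha> / r powr \<alpha>"
        "((real n - 1) / r) powr \<alpha> = (real n - 1) powr \<alpha> / r powr \<alpha>"
        using r n by (auto intro!: powr_divide)
      ultimately have "(real n powr \<alpha> - (real n - 1) powr \<alpha>) / r powr \<alpha> < \<epsilon>"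
        by (simp add: diff_divide_distrib)
      then show "real n powr \<alpha> - (real n - 1) powr \<alpha> \<le> \<epsilon> * r powr \<alpha>"
        using r by (simp add: divide_less_eq)
    qed
  qed
qed

text \<open>The half-open interval makes negative values of \<open>D\<close> count as bad as well,
  since \<open>D\<close> is not assumed nonnegative; this controls the distribution function on both
  sides of 0.\<close>

lemma weak_conv_m_return_0:
  fixes P :: "nat \<Rightarrow> 'a pmf" and D :: "nat \<Rightarrow> 'a \<Rightarrow> real"
  assumes "\<And>\<epsilon>. \<epsilon> > 0 \<Longrightarrow> (\<lambda>m. measure_pmf.prob (P m) {X. D m X \<notin> {0..<\<epsilon>}}) \<longlonglongrightarrow> 0"
  shows "weak_conv_m (\<lambda>m. distr (measure_pmf (P m)) borel (D m)) (return borel 0)"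
  unfolding weak_conv_m_def weak_conv_def
proof (intro allI impI)
  fix x :: real
  assume cont: "isCont (cdf (return borel 0)) x"
  have cdf_return: "cdf (return borel 0) y = (if 0 \<le> y then 1 else 0)" for y :: real
    by (simp add: cdf_def measure_return)
  have cdf_distr: "cdf (distr (measure_pmf (P m)) borel (D m)) x = measure_pmf.prob (P m) {X. D m X \<le> x}" for m
    by (simp add: cdf_def measure_distr vimage_def)
  consider "x < 0" | "x = 0" | "x > 0" by linarith
  then show "(\<lambda>m. cdf (distr (measure_pmf (P m)) borel (D m)) x) \<longlonglongrightarrow> cdf (return borel 0) x"
  proof cases
    case 1
    have "(\<lambda>m. measure_pmf.prob (P m) {X. D m X \<le> x}) \<longlonglongrightarrow> 0"
    proof (rule tendsto_sandwich[OF _ _ tendsto_const assms[of 1]])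
      show "eventually (\<lambda>m. measure_pmf.prob (P m) {X. D m X \<le> x}
          \<le> measure_pmf.prob (P m) {X. D m X \<notin> {0..<1}}) sequentially"
        using 1 by (intro always_eventually allI measure_pmf.finite_measure_mono) auto
    qed auto
    then show ?thesis using 1 by (simp add: cdf_return cdf_distr)
  next
    case 2
    \<comment> \<open>The limiting distribution function jumps at 0, so 0 is not among its
      continuity points.\<close>
    have "(\<lambda>n. - inverse (real (Suc n))) \<longlonglongrightarrow> 0"
      using tendsto_minus[OF LIMSEQ_inverse_real_of_nat] by simp
    then have "(\<lambda>n. cdf (return borel 0) (- inverse (real (Suc n)))) \<longlonglongrightarrow> cdf (return borel 0) (0::real)"
      using cont 2 by (intro isCont_tendsto_compose[where g = "cdf (return borel 0)"]) auto
    then have "(\<lambda>n::nat. 0::real) \<longlonglongrightarrow> 1"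
      by (simp add: cdf_return)
    then have False using LIMSEQ_unique[OF tendsto_const] by fastforce
    then show ?thesis ..
  next
    case 3
    have "(\<lambda>m. measure_pmf.prob (P m) {X. D m X \<le> x}) \<longlonglongrightarrow> 1"
    proof (rule tendsto_sandwich)
      show "(\<lambda>m. 1 - measure_pmf.prob (P m) {X. D m X \<notin> {0..<x}}) \<longlonglongrightarrow> 1"
        using tendsto_diff[OF tendsto_const assms[OF 3], of 1] by simp
      have "1 - measure_pmf.prob (P m) {X. D m X \<notin> {0..<x}} \<le> measure_pmf.prob (P m) {X. D m X \<le> x}" for m
      proof -
        have "1 - measure_pmf.prob (P m) {X. D m X \<notin> {0..<x}} = measure_pmf.prob (P m) (- {X. D m X \<notin> {0..<x}})"
          by (subst measure_pmf.prob_compl[symmetric]) (auto simp: Compl_eq_Diff_UNIV)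
        also have "\<dots> \<le> measure_pmf.prob (P m) {X. D m X \<le> x}"
          by (intro measure_pmf.finite_measure_mono) auto
        finally show ?thesis .
      qed
      then show "eventually (\<lambda>m. 1 - measure_pmf.prob (P m) {X. D m X \<notin> {0..<x}}
          \<le> measure_pmf.prob (P m) {X. D m X \<le> x}) sequentially" by simp
    qed auto
    then show ?thesis using 3 by (simp add: cdf_return cdf_distr)
  qed
qed

section \<open>Limit points of states with small loss and bounded spread\<close>

locale greedy_sequence = packing B b
  for B :: "'n::finite \<Rightarrow> real" and b :: "'i::finite \<Rightarrow> 'n \<Rightarrow> real" +
  fixes \<mu> \<rho> :: "'i \<Rightarrow> real" and \<alpha> :: real and r :: "nat \<Rightarrow> real"
    and sel :: "nat \<Rightarrow> 'i \<Rightarrow> 'i state \<Rightarrow> 'i aconf"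
  assumes system: "greedy_system B b \<mu> \<rho> \<alpha> (r m) (sel m)"
    and r_at_top: "filterlim r at_top sequentially"

sublocale greedy_sequence \<subseteq> G: greedy_system B b \<mu> \<rho> \<alpha> "r m" "sel m" for m
  by (rule system)

context greedy_sequence
begin

lemma r_pos: "r m > 0"
  using G.r_ge_1[of m] by simp

lemma inverse_r: "(\<lambda>m. c / r m) \<longlonglongrightarrow> 0"
  by (rule tendsto_divide_0[OF tendsto_const]) (rule filterlim_at_top_imp_at_infinity[OF r_at_top])

text \<open>The deterministic core, reducing to \<open>optimalI\<close>. A vanishing scaled loss
  yields the greedy condition; for the spread condition a bound with any constant \<open>M\<close>
  is enough, because its right-hand side tends to a multiple of
  \<open>sqrt (x \<kappa>)\<close>.\<close>

lemma limit_optimal: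
  fixes X :: "nat \<Rightarrow> 'i state" and x :: "'i config \<Rightarrow> real"
  assumes X: "\<And>m. X m \<in> closed_states B b \<rho> (r m)"
    and conv: "\<And>k. k \<in> configs B b \<Longrightarrow> (\<lambda>m. fluid (r m) (X m) k) \<longlonglongrightarrow> x k"
    and x0: "\<And>k. k \<notin> configs B b \<Longrightarrow> x k = 0"
    and loss0: "(\<lambda>m. G.total_loss m (X m) / r m powr (1 + \<alpha>)) \<longlonglongrightarrow> 0"
    and spread: "\<And>m \<kappa> i. \<kappa> \<in> configs B b \<Longrightarrow> add_cust i \<kappa> \<in> configs0 B b \<Longrightarrow>
        real (X m (add_cust i \<kappa>)) * real (agg (X m) (cls \<kappa>)) / sqrt (real (X m \<kappa>) + 2)
          \<le> M * (r m * sqrt (r m))"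
  shows "x \<in> optimal B b \<rho> \<alpha>"
proof (rule optimalI[OF G.alpha_pos])
  have Xconv: "(\<lambda>m. real (X m k) / r m) \<longlonglongrightarrow> x k" for k
    using conv[of k] x0[of k] G.statesD(1)[OF X, of k] by (cases "k \<in> configs B b") (auto simp: fluid_def)
  have xnn: "x k \<ge> 0" for k
    by (rule LIMSEQ_le_const[OF Xconv]) (use r_pos in \<open>auto intro!: divide_nonneg_pos\<close>)
  have "(\<Sum>k\<in>configs B b. real (k i) * x k) = \<rho> i" for i
  proof (rule LIMSEQ_unique)
    show "(\<lambda>m. \<Sum>k\<in>configs B b. real (k i) * (real (X m k) / r m)) \<longlonglongrightarrow> (\<Sum>k\<in>configs B b. real (k i) * x k)"
      by (intro tendsto_sum tendsto_mult tendsto_const Xconv)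
    have "(\<Sum>k\<in>configs B b. real (k i) * (real (X m k) / r m)) = \<rho> i" for m
      using G.statesD(2)[OF X, of i m] r_pos[of m]
      by (simp add: sum_divide_distrib[symmetric])
    then show "(\<lambda>m. \<Sum>k\<in>configs B b. real (k i) * (real (X m k) / r m)) \<longlonglongrightarrow> \<rho> i"
      by simp
  qed
  then show "x \<in> feasible B b \<rho>" using xnn x0 by (simp add: feasible_def)
  have agg_conv: "(\<lambda>m. real (agg (X m) q) / r m) \<longlonglongrightarrow> agg x q" for q
    unfolding agg_def of_nat_sum sum_divide_distrib by (intro tendsto_sum Xconv)

  fix k i assume k: "k \<in> configs B b" "x k > 0" "k i > 0"
  define \<kappa> where "\<kappa> = del_cust i k"
  have \<kappa>: "\<kappa> \<in> configs0 B b" "add_cust i \<kappa> = k"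
    using k del_cust_in_configs0[of k i] add_del_cust[where k = k and i = i]
    by (auto simp: configs_configs0 \<kappa>_def)

  show "x (del_cust i k) > 0" if "del_cust i k \<noteq> empty_config" "agg x (cls (del_cust i k)) > 0"
  proof -
    have ineq: "(real (X m k) / r m) * (real (agg (X m) (cls \<kappa>)) / r m)
        \<le> M * sqrt (real (X m \<kappa>) / r m + 2 / r m)" for m
    proof -
      have "real (X m k) * real (agg (X m) (cls \<kappa>)) \<le> M * (r m * sqrt (r m)) * sqrt (real (X m \<kappa>) + 2)"
        using spread[of \<kappa> i m] \<kappa> that k by (simp add: configs_def \<kappa>_def divide_le_eq)
      also have "sqrt (real (X m \<kappa>) + 2) = sqrt (r m) * sqrt (real (X m \<kappa>) / r m + 2 / r m)"
        using r_pos[of m] by (simp add: real_sqrt_mult[symmetric] distrib_left)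
      also have "M * (r m * sqrt (r m)) * (sqrt (r m) * sqrt (real (X m \<kappa>) / r m + 2 / r m))
          = M * sqrt (real (X m \<kappa>) / r m + 2 / r m) * (r m * (sqrt (r m) * sqrt (r m)))"
        by (simp add: mult_ac)
      also have "sqrt (r m) * sqrt (r m) = r m" using r_pos[of m] by simp
      finally show ?thesis using r_pos[of m] by (simp add: divide_le_eq)
    qed
    have "x k * agg x (cls \<kappa>) \<le> M * sqrt (x \<kappa> + 0)"
    proof (rule LIMSEQ_le)
      show "(\<lambda>m. (real (X m k) / r m) * (real (agg (X m) (cls \<kappa>)) / r m)) \<longlonglongrightarrow> x k * agg x (cls \<kappa>)"
        by (intro tendsto_mult Xconv agg_conv)
      show "(\<lambda>m. M * sqrt (real (X m \<kappa>) / r m + 2 / r m)) \<longlonglongrightarrow> M * sqrt (x \<kappa> + 0)"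
        by (intro tendsto_mult tendsto_const tendsto_real_sqrt tendsto_add Xconv inverse_r)
    qed (use ineq in blast)
    moreover have "x k * agg x (cls \<kappa>) > 0" using k that by (simp add: \<kappa>_def)
    ultimately have "x \<kappa> \<noteq> 0" by auto
    then show ?thesis using xnn[of \<kappa>] by (simp add: \<kappa>_def)
  qed

  fix k' assume k': "k' \<in> configs0 B b" "add_cust i k' \<in> configs0 B b"
    "k' = empty_config \<or> agg x (cls k') > 0"
  \<comment> \<open>The state in which the rule places the customer; it differs from
    \<open>X m\<close> by one server and so has the same fluid limit.\<close>
  define X' where "X' m = change_server k \<kappa> (X m)" for m
  have Xk: "eventually (\<lambda>m. X m k > 0) sequentially"
    using order_tendstoD(1)[OF Xconv k(2)]
    by eventually_elim (use r_pos in \<open>auto simp: zero_less_divide_iff\<close>)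
  have X'0: "X' m empty_config = 0" for m
    using G.statesD(1)[OF X] by (simp add: X'_def)
  have agg_conv': "(\<lambda>m. real (agg (X' m) q) / r m) \<longlonglongrightarrow> agg x q" if q: "q \<in> aconfs0 B b" for q
  proof (rule Lim_transform[OF agg_conv[of q]])
    show "(\<lambda>m. real (agg (X' m) q) / r m - real (agg (X m) q) / r m) \<longlonglongrightarrow> 0"
    proof (rule Lim_null_comparison[OF _ inverse_r[of 1]])
      show "eventually (\<lambda>m. norm (real (agg (X' m) q) / r m - real (agg (X m) q) / r m) \<le> 1 / r m) sequentially"
        using Xk
      proof eventually_elim
        case (elim m)
        have "\<bar>real (agg (X' m) q) - real (agg (X m) q)\<bar> \<le> 1"
        proof (cases "empty_config \<in> q")
          case True
          then have "q = {empty_config}" using aconfs0_cls[OF q] cls_empty by simp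
          then show ?thesis using X'0[of m] by (simp add: agg_def X'_def)
        next
          case False
          then show ?thesis
            using agg_change_server[where k = k and X = "X m" and k' = \<kappa> and q = q] q elim
            by (auto simp: aconfs_iff X'_def)
        qed
        then show ?case using r_pos[of m]
          by (simp add: diff_divide_distrib[symmetric] divide_right_mono)
      qed
    qed
  qed
  have powr_conv: "(\<lambda>m. real (agg (X' m) q) powr \<alpha> / r m powr \<alpha>) \<longlonglongrightarrow> agg x q powr \<alpha>"
    if q: "q \<in> aconfs0 B b" for q
  proof -
    have "(\<lambda>m. (real (agg (X' m) q) / r m) powr \<alpha>) \<longlonglongrightarrow> agg x q powr \<alpha>"
      using r_pos G.alpha_pos
      \<comment> \<open>The limit may be 0, so continuity of the power rests on nonnegative bases
        and a positive exponent.\<close>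
      by (intro tendsto_powr' agg_conv' q tendsto_const disjI2) (auto intro!: always_eventually divide_nonneg_pos)
    then show ?thesis by (simp add: powr_divide)
  qed
  have weight_conv: "(\<lambda>m. greedy_weight B b \<alpha> (X' m) i (cls h) / r m powr \<alpha>)
      \<longlonglongrightarrow> agg x (cls (add_cust i h)) powr \<alpha> - agg x (cls h) powr \<alpha>"
    if h: "h \<in> configs0 B b" "add_cust i h \<in> configs0 B b" for h
  proof -
    have "greedy_weight B b \<alpha> (X' m) i (cls h)
        = real (agg (X' m) (cls (add_cust i h))) powr \<alpha> - real (agg (X' m) (cls h)) powr \<alpha>" for m
      using add_aconf_cls[OF h] X'0[of m] by (auto simp: greedy_weight_def empty_aconf_eq cls_empty agg_def)
    then show ?thesis
      by (simp add: diff_divide_distrib tendsto_diff powr_conv cls_in_aconfs0 h)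
  qed
  let ?w = "\<lambda>h. agg x (cls (add_cust i h)) powr \<alpha> - agg x (cls h) powr \<alpha>"
  let ?W = "\<lambda>h m. greedy_weight B b \<alpha> (X' m) i (cls h) / r m powr \<alpha>"
  \<comment> \<open>The rule does at least as well as \<open>k'\<close>, so this is the limit of a
    lower bound for one summand of the scaled total loss, which tends to 0.\<close>
  have "\<mu> i * x k * (?w \<kappa> - ?w k') \<le> 0"
  proof (rule tendsto_le[OF _ loss0])
    show "(\<lambda>m. \<mu> i * (real (X m k) / r m) * (?W \<kappa> m - ?W k' m)) \<longlonglongrightarrow> \<mu> i * x k * (?w \<kappa> - ?w k')"
      using \<kappa> k k' by (intro tendsto_mult tendsto_diff tendsto_const Xconv weight_conv) (auto simp: configs_configs0)
    have "eventually (\<lambda>m. placeable B b (X' m) i (cls k')) sequentially"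
    proof (cases "k' = empty_config")
      case True
      then show ?thesis using k' by (intro always_eventually allI placeable_cls) auto
    next
      case False
      then have "agg x (cls k') > 0" using k'(3) by simp
      from order_tendstoD(1)[OF agg_conv'[OF cls_in_aconfs0[OF k'(1)]] this]
      show ?thesis
        by eventually_elim
          (use r_pos add_aconf_cls[OF k'(1,2)] cls_in_aconfs0[OF k'(1)] in
            \<open>auto simp: zero_less_divide_iff placeable_def\<close>)
    qed
    then show "eventually (\<lambda>m. \<mu> i * (real (X m k) / r m) * (?W \<kappa> m - ?W k' m)
        \<le> G.total_loss m (X m) / r m powr (1 + \<alpha>)) sequentially"
    proof eventually_elim
      case (elim m)
      let ?D = "greedy_weight B b \<alpha> (X' m) i (cls \<kappa>) - greedy_weight B b \<alpha> (X' m) i (cls k')"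
      let ?t = "\<lambda>k i. \<mu> i * real (k i) * real (X m k) * G.loss m k i (X m)"
      have nn: "?t h j \<ge> 0" if "h \<in> configs B b" for h j
        using G.loss_nonneg[OF that, of j m "X m"] G.mu_pos[of j] by (cases "h j > 0") auto
      have "\<mu> i * real (X m k) * ?D \<le> \<mu> i * real (X m k) * G.loss m k i (X m)"
        using G.sel_minimal[OF elim, of m] G.mu_pos[of i]
        by (intro mult_left_mono) (auto simp: G.loss_def X'_def \<kappa>_def Let_def)
      also have "\<dots> = \<mu> i * 1 * real (X m k) * G.loss m k i (X m)" by simp
      also have "\<dots> \<le> ?t k i"
        using k(3) G.mu_pos[of i] G.loss_nonneg[OF k(1,3)]
        by (intro mult_right_mono mult_left_mono) auto
      also have "\<dots> \<le> (\<Sum>i\<in>UNIV. ?t k i)"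
        using nn k(1) by (intro member_le_sum) auto
      also have "\<dots> \<le> G.total_loss m (X m)"
        unfolding G.total_loss_def using nn k(1)
        by (intro member_le_sum[where f = "\<lambda>k. \<Sum>i\<in>UNIV. ?t k i"] sum_nonneg) auto
      finally have "\<mu> i * real (X m k) * ?D / r m powr (1 + \<alpha>) \<le> G.total_loss m (X m) / r m powr (1 + \<alpha>)"
        by (rule divide_right_mono) simp
      moreover have "r m powr (1 + \<alpha>) = r m * r m powr \<alpha>"
        using r_pos[of m] by (simp add: powr_add)
      ultimately show ?case
        by (simp add: diff_divide_distrib[symmetric])
    qed
  qed simp
  then have "?w \<kappa> - ?w k' \<le> 0"
    using k(2) G.mu_pos[of i] by (simp add: mult_le_0_iff zero_less_mult_iff not_less[symmetric])
  then show "agg x (cls k) powr \<alpha> - agg x (cls (del_cust i k)) powr \<alpha>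
      \<le> agg x (cls (add_cust i k')) powr \<alpha> - agg x (cls k') powr \<alpha>"
    using \<kappa>(2) by (simp add: \<kappa>_def)
qed

end

section \<open>Concentration of the stationary law near the optimal set\<close>

lemma pmf_Markov:
  fixes u :: "'a \<Rightarrow> real"
  assumes "finite (set_pmf p)" "\<And>x. u x \<ge> 0" "c > 0"
  shows "measure_pmf.prob p {x. u x \<ge> c} \<le> measure_pmf.expectation p u / c"
  using integral_Markov_inequality_measure[OF integrable_measure_pmf_finite[OF assms(1)], of UNIV u c] assms
  by simp

text \<open>The value 0 for inadmissible additions lets one sum over all pairs, and hence one Markov
  bound, control every ratio at once.\<close>

definition (in packing) spread_ratio :: "'i config \<Rightarrow> 'i \<Rightarrow> 'i state \<Rightarrow> real" where
  "spread_ratio \<kappa> i X = (if add_cust i \<kappa> \<in> configs0 B b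
     then real (X (add_cust i \<kappa>)) * real (agg X (cls \<kappa>)) / sqrt (real (X \<kappa>) + 2) else 0)"

definition (in packing) total_spread :: "'i state \<Rightarrow> real" where
  "total_spread X = (\<Sum>\<kappa>\<in>configs B b. \<Sum>i\<in>UNIV. spread_ratio \<kappa> i X)"

lemma (in packing) spread_ratio_nonneg: "spread_ratio \<kappa> i X \<ge> 0"
  by (simp add: spread_ratio_def)

lemma (in packing) total_spread_nonneg: "total_spread X \<ge> 0"
  by (simp add: total_spread_def sum_nonneg spread_ratio_nonneg)

lemma (in packing) spread_ratio_le_total:
  assumes "\<kappa> \<in> configs B b" shows "spread_ratio \<kappa> i X \<le> total_spread X"
proof -
  have "spread_ratio \<kappa> i X \<le> (\<Sum>i\<in>UNIV. spread_ratio \<kappa> i X)"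
    by (intro member_le_sum) (auto simp: spread_ratio_nonneg)
  also have "\<dots> \<le> total_spread X"
    unfolding total_spread_def using assms
    by (intro member_le_sum[where f = "\<lambda>\<kappa>. \<Sum>i\<in>UNIV. spread_ratio \<kappa> i X"])
      (auto intro: sum_nonneg spread_ratio_nonneg)
  finally show ?thesis .
qed

context greedy_system
begin

lemma expected_total_spread_le:
  assumes "stationary_dist states (closed_rate B b \<mu> sel) \<pi>"
  shows "measure_pmf.expectation \<pi> total_spread \<le> (\<Sum>\<kappa>\<in>configs B b. \<Sum>j\<in>UNIV.
      if add_cust j \<kappa> \<in> configs0 B b then 2 / \<mu> j * (6 * \<Lambda> + 2 * (\<Sum>i\<in>UNIV. \<mu> i * real (\<kappa> i))) else 0)
      * (r * sqrt r)"
proof -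
  have "finite (set_pmf \<pi>)"
    using assms finite_states finite_subset by (auto simp: stationary_dist_def)
  then have int: "integrable \<pi> f" for f :: "'i state \<Rightarrow> real"
    by (rule integrable_measure_pmf_finite)
  have "measure_pmf.expectation \<pi> total_spread
      = (\<Sum>\<kappa>\<in>configs B b. \<Sum>j\<in>UNIV. measure_pmf.expectation \<pi> (spread_ratio \<kappa> j))"
    unfolding total_spread_def by (simp add: Bochner_Integration.integral_sum int)
  also have "\<dots> \<le> (\<Sum>\<kappa>\<in>configs B b. \<Sum>j\<in>UNIV.
      (if add_cust j \<kappa> \<in> configs0 B b then 2 / \<mu> j * (6 * \<Lambda> + 2 * (\<Sum>i\<in>UNIV. \<mu> i * real (\<kappa> i))) else 0)
      * (r * sqrt r))"
    using expected_spread_le[OF assms] by (intro sum_mono) (auto simp: spread_ratio_def[abs_def])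
  finally show ?thesis by (simp add: sum_distrib_right)
qed

end

context greedy_sequence
begin

text \<open>Compactness by contradiction: states violating the claim for
  \<open>\<delta> = 1 / (n + 1)\<close> have a fluid limit point, which \<open>limit_optimal\<close>
  shows to be optimal. The threshold \<open>\<delta>\<close> may depend on \<open>M\<close>.\<close>

lemma close_to_optimal:
  assumes "\<epsilon> > 0"
  shows "\<exists>\<delta>>0. eventually (\<lambda>m. \<forall>X\<in>closed_states B b \<rho> (r m).
     G.total_loss m X \<le> \<delta> * r m powr (1 + \<alpha>) \<longrightarrow> total_spread X \<le> M * (r m * sqrt (r m)) \<longrightarrow>
     eucl_setdist (configs B b) (fluid (r m) X) (optimal B b \<rho> \<alpha>) \<in> {0..<\<epsilon>}) sequentially"
    (is "\<exists>\<delta>>0. eventually (?P \<delta>) _")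
proof (rule ccontr)
  let ?d = "\<lambda>m X. eucl_setdist (configs B b) (fluid (r m) X) (optimal B b \<rho> \<alpha>)"
  let ?Q = "\<lambda>n m X. n \<le> m \<and> X \<in> closed_states B b \<rho> (r m) \<and>
      G.total_loss m X \<le> inverse (real (Suc n)) * r m powr (1 + \<alpha>) \<and>
      total_spread X \<le> M * (r m * sqrt (r m)) \<and> ?d m X \<notin> {0..<\<epsilon>}"
  assume neg: "\<not> (\<exists>\<delta>>0. eventually (?P \<delta>) sequentially)"
  have "\<exists>m X. ?Q n m X" for n
  proof -
    have "0 < inverse (real (Suc n))" by simp
    then have "\<not> eventually (?P (inverse (real (Suc n)))) sequentially" using neg by blast
    then obtain m where "n \<le> m" "\<not> ?P (inverse (real (Suc n))) m"
      unfolding eventually_sequentially by blast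
    then show ?thesis by blast
  qed
  then obtain t Y where tY: "?Q n (t n) (Y n)" for n
    by metis
  have "\<bar>fluid (r (t n)) (Y n) k\<bar> \<le> 1" for n k
    using G.states_le[of "Y n" "t n" k] tY[of n] r_pos[of "t n"] by (simp add: fluid_def)
  then obtain s l where s: "strict_mono (s :: nat \<Rightarrow> nat)"
    and l: "\<And>k. k \<in> configs B b \<Longrightarrow> (\<lambda>n. fluid (r (t (s n))) (Y (s n)) k) \<longlonglongrightarrow> l k"
    using convergent_subseq_finite[OF finite_configs, of "\<lambda>n. fluid (r (t n)) (Y n)" 1] by blast
  define x where "x k = (if k \<in> configs B b then l k else 0)" for k
  have "filterlim t at_top sequentially"
    by (rule filterlim_at_top_mono[OF filterlim_ident]) (use tY in auto)
  then have ts: "filterlim (\<lambda>n. t (s n)) at_top sequentially"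
    by (rule filterlim_compose) (rule filterlim_subseq[OF s])
  \<comment> \<open>Along the extracted indices the systems again form a greedy sequence, so
    \<open>limit_optimal\<close> can be applied to them.\<close>
  have seq: "greedy_sequence B b \<mu> \<rho> \<alpha> (\<lambda>n. r (t (s n))) (\<lambda>n. sel (t (s n)))"
    by unfold_locales (use filterlim_compose[OF r_at_top ts] system in auto)
  have conv: "(\<lambda>n. fluid (r (t (s n))) (Y (s n)) k) \<longlonglongrightarrow> x k" if "k \<in> configs B b" for k
    using l that by (simp add: x_def)
  have x: "x \<in> optimal B b \<rho> \<alpha>"
  proof (rule greedy_sequence.limit_optimal[OF seq _ conv])
    show "(\<lambda>n. G.total_loss (t (s n)) (Y (s n)) / r (t (s n)) powr (1 + \<alpha>)) \<longlonglongrightarrow> 0"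
    proof (rule tendsto_sandwich[OF _ _ tendsto_const])
      show "(\<lambda>n. inverse (real (Suc (s n)))) \<longlonglongrightarrow> 0"
        using LIMSEQ_subseq_LIMSEQ[OF LIMSEQ_inverse_real_of_nat s] by (simp add: o_def)
      show "eventually (\<lambda>n. G.total_loss (t (s n)) (Y (s n)) / r (t (s n)) powr (1 + \<alpha>)
          \<le> inverse (real (Suc (s n)))) sequentially"
      proof (intro always_eventually allI)
        fix n
        have "0 < r (t (s n)) powr (1 + \<alpha>)" using r_pos[of "t (s n)"] by simp
        then show "G.total_loss (t (s n)) (Y (s n)) / r (t (s n)) powr (1 + \<alpha>) \<le> inverse (real (Suc (s n)))"
          using tY[of "s n"] by (simp only: pos_divide_le_eq)
      qed
    qed (simp add: G.total_loss_nonneg)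
    fix n \<kappa> i assume "\<kappa> \<in> configs B b" "add_cust i \<kappa> \<in> configs0 B b"
    then show "real (Y (s n) (add_cust i \<kappa>)) * real (agg (Y (s n)) (cls \<kappa>)) / sqrt (real (Y (s n) \<kappa>) + 2)
        \<le> M * (r (t (s n)) * sqrt (r (t (s n))))"
      using spread_ratio_le_total[of \<kappa> i "Y (s n)"] tY[of "s n"] by (simp add: spread_ratio_def)
  qed (use tY in \<open>auto simp: x_def\<close>)
  let ?L = "\<lambda>n y. L2_set (\<lambda>k. fluid (r (t (s n))) (Y (s n)) k - y k) (configs B b)"
  have bdd: "bdd_below (?L n ` optimal B b \<rho> \<alpha>)" for n
    by (intro bdd_belowI[of _ 0]) auto
  have le: "?d (t (s n)) (Y (s n)) \<le> ?L n x" for n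
    unfolding eucl_setdist_def using cINF_lower[OF bdd x] .
  \<comment> \<open>The limit point \<open>x\<close> also witnesses that the optimal set is
    nonempty, without which the infimum would carry no information.\<close>
  have nn: "0 \<le> ?d (t (s n)) (Y (s n))" for n
    unfolding eucl_setdist_def using x by (intro cINF_greatest) auto
  have "(\<lambda>n. sqrt (\<Sum>k\<in>configs B b. (fluid (r (t (s n))) (Y (s n)) k - x k)\<^sup>2))
      \<longlonglongrightarrow> sqrt (\<Sum>k\<in>configs B b. (x k - x k)\<^sup>2)"
    by (intro tendsto_real_sqrt tendsto_sum tendsto_power tendsto_diff tendsto_const conv)
  then have "(\<lambda>n. ?L n x) \<longlonglongrightarrow> 0" by (simp add: L2_set_def)
  from order_tendstoD(2)[OF this assms] obtain n where "?L n x < \<epsilon>"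
    by (auto simp: eventually_sequentially)
  then show False using le[of n] nn[of n] tY[of "s n"] by auto
qed

lemma prob_far_from_optimal:
  assumes \<pi>: "\<And>m. stationary_dist (closed_states B b \<rho> (r m)) (closed_rate B b \<mu> (sel m)) (\<pi> m)"
    and "\<epsilon> > 0"
  shows "(\<lambda>m. measure_pmf.prob (\<pi> m)
     {X. eucl_setdist (configs B b) (fluid (r m) X) (optimal B b \<rho> \<alpha>) \<notin> {0..<\<epsilon>}}) \<longlonglongrightarrow> 0"
proof (rule tendstoI)
  let ?bad = "\<lambda>m. {X. eucl_setdist (configs B b) (fluid (r m) X) (optimal B b \<rho> \<alpha>) \<notin> {0..<\<epsilon>}}"
  fix e :: real assume e: "e > 0"
  \<comment> \<open>Unfolding \<open>\<Lambda>\<close> exposes that the constant depends on the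
    rates and configurations only, not on \<open>m\<close>.\<close>
  obtain C where C: "\<And>m. measure_pmf.expectation (\<pi> m) total_spread \<le> C * (r m * sqrt (r m))"
    using G.expected_total_spread_le[OF \<pi>] unfolding G.\<Lambda>_def by blast
  \<comment> \<open>Makes \<open>C / M < e / 2\<close>; adding 1 to the absolute value keeps
    \<open>M\<close> positive whatever \<open>C\<close> is. Then \<open>\<delta>\<close> is chosen
    from \<open>M\<close>, and \<open>\<eta>\<close> from \<open>\<delta>\<close>, so that each of
    the two exceptional events has probability below \<open>e / 2\<close>.\<close>
  define M where "M = 2 * (\<bar>C\<bar> + 1) / e"
  have half: "e * c / (2 * (\<bar>c\<bar> + 1)) < e / 2" for c :: real
  proof -
    have "c / (\<bar>c\<bar> + 1) < 1" by (subst divide_less_eq_1_pos) linarith+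
    from mult_strict_left_mono[OF this, of "e / 2"] show ?thesis using e by simp
  qed
  have M: "M > 0" "C / M < e / 2"
    using e half[of C] by (auto simp: M_def mult.commute)
  obtain \<delta> where \<delta>: "\<delta> > 0" and ev: "eventually (\<lambda>m. \<forall>X\<in>closed_states B b \<rho> (r m).
     G.total_loss m X \<le> \<delta> * r m powr (1 + \<alpha>) \<longrightarrow> total_spread X \<le> M * (r m * sqrt (r m)) \<longrightarrow>
     X \<notin> ?bad m) sequentially"
    using close_to_optimal[OF assms(2), of M] by auto
  define L where "L = (\<Sum>i\<in>UNIV. \<mu> i * \<rho> i)"
  define \<eta> where "\<eta> = e * \<delta> / (2 * (\<bar>L\<bar> + 1))"
  have \<eta>: "\<eta> > 0" "\<eta> * L / \<delta> < e / 2"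
    using e \<delta> half[of L] by (auto simp: \<eta>_def mult_ac)
  from powr_increment_small[OF G.alpha_pos \<eta>(1)]
  have "eventually (\<lambda>m. \<forall>n::nat. 1 \<le> n \<longrightarrow> real n \<le> 2 * r m \<longrightarrow>
      real n powr \<alpha> - (real n - 1) powr \<alpha> \<le> \<eta> * r m powr \<alpha>) sequentially"
    using r_at_top by (rule eventually_compose_filterlim)
  then show "eventually (\<lambda>m. dist (measure_pmf.prob (\<pi> m) (?bad m)) 0 < e) sequentially"
    using ev
  proof eventually_elim
    case (elim m)
    have sub: "set_pmf (\<pi> m) \<subseteq> closed_states B b \<rho> (r m)"
      using \<pi> by (simp add: stationary_dist_def)
    have fin: "finite (set_pmf (\<pi> m))"
      using sub G.finite_states finite_subset by blast
    let ?A = "{X. G.total_loss m X \<ge> \<delta> * r m powr (1 + \<alpha>)}"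
    let ?S = "{X. total_spread X \<ge> M * (r m * sqrt (r m))}"
    have rs: "r m * sqrt (r m) > 0" "r m powr (1 + \<alpha>) > 0"
      using r_pos[of m] by simp_all
    have "measure_pmf.prob (\<pi> m) ?A \<le> measure_pmf.expectation (\<pi> m) (G.total_loss m) / (\<delta> * r m powr (1 + \<alpha>))"
      using \<delta> rs by (intro pmf_Markov fin G.total_loss_nonneg) simp
    also have "\<dots> \<le> (\<eta> * r m powr \<alpha> * (L * r m)) / (\<delta> * r m powr (1 + \<alpha>))"
      using G.expected_loss_le[OF \<pi>, where e = "\<eta> * r m powr \<alpha>"] elim(1) \<eta>(1) \<delta> rs
      unfolding G.\<Lambda>_def L_def[symmetric] by (intro divide_right_mono) auto
    also have "\<dots> = \<eta> * L / \<delta>"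
      using \<delta> r_pos[of m] by (simp add: powr_add)
    finally have A: "measure_pmf.prob (\<pi> m) ?A < e / 2" using \<eta>(2) by linarith
    have "measure_pmf.prob (\<pi> m) ?S \<le> measure_pmf.expectation (\<pi> m) total_spread / (M * (r m * sqrt (r m)))"
      using M rs by (intro pmf_Markov fin total_spread_nonneg) simp
    also have "\<dots> \<le> (C * (r m * sqrt (r m))) / (M * (r m * sqrt (r m)))"
      using C[of m] M rs by (intro divide_right_mono) auto
    also have "\<dots> = C / M" using rs by simp
    finally have S: "measure_pmf.prob (\<pi> m) ?S < e / 2" using M(2) by linarith
    have "measure_pmf.prob (\<pi> m) (?bad m) \<le> measure_pmf.prob (\<pi> m) (?A \<union> ?S)"
    proof (rule measure_pmf.finite_measure_mono_AE)
      show "AE X in \<pi> m. X \<in> ?bad m \<longrightarrow> X \<in> ?A \<union> ?S"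
        unfolding AE_measure_pmf_iff
      proof (intro ballI impI)
        fix X assume "X \<in> set_pmf (\<pi> m)" "X \<in> ?bad m"
        then have "\<not> (G.total_loss m X \<le> \<delta> * r m powr (1 + \<alpha>) \<and> total_spread X \<le> M * (r m * sqrt (r m)))"
          using elim(2) sub by blast
        then show "X \<in> ?A \<union> ?S" by auto
      qed
    qed simp
    also have "\<dots> \<le> measure_pmf.prob (\<pi> m) ?A + measure_pmf.prob (\<pi> m) ?S"
      by (rule measure_Un_le) auto
    finally show ?case using A S by simp
  qed
qed

end

theorem theorem19:
  fixes B :: "'n::finite \<Rightarrow> real"
    and b :: "'i::finite \<Rightarrow> 'n \<Rightarrow> real"
    and lam \<mu> \<rho> :: "'i \<Rightarrow> real"
    and \<alpha> :: real
    and r :: "nat \<Rightarrow> real"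
    and sel :: "nat \<Rightarrow> 'i \<Rightarrow> 'i state \<Rightarrow> 'i aconf"
    and \<pi> :: "nat \<Rightarrow> 'i state pmf"
  assumes "\<And>n. B n > 0"
    and "\<And>i n. b i n > 0"
    and "\<And>i. add_cust i empty_config \<in> configs0 B b"
    and "\<And>i. lam i > 0"
    and "\<And>i. \<mu> i > 0"
    and "\<And>i. \<rho> i = lam i / \<mu> i"
    and "(\<Sum>i\<in>UNIV. \<rho> i) = 1"
    and "\<alpha> > 0"
    and "\<And>m. r m \<ge> 1"
    and "strict_mono r"
    and "filterlim r at_top sequentially"
    and "\<And>m i. \<rho> i * r m \<in> \<int>"
    and "\<And>m. greedy_rule B b \<alpha> (sel m)"
    and "\<And>m. stationary_dist (closed_states B b \<rho> (r m)) (closed_rate B b \<mu> (sel m)) (\<pi> m)"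
  shows "weak_conv_m
           (\<lambda>m. distr (measure_pmf (\<pi> m)) borel
              (\<lambda>X. eucl_setdist (configs B b) (fluid (r m) X) (optimal B b \<rho> \<alpha>)))
           (return borel 0)"
proof -
  interpret greedy_sequence B b \<mu> \<rho> \<alpha> r sel
    by unfold_locales (use assms in auto)
  show ?thesis
    using prob_far_from_optimal[OF assms(14)] by (intro weak_conv_m_return_0)
qed

end
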